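(* Let $H$ be a nonzero complex Hilbert space, let $\Phi: B(H)\to B(H)$ be a unital positive linear map, and let $n\ge 2$ be an integer. Let $0<t\le 1$, let $\mathbb{A}=(A_1,\dots,A_n)$ be an $n$-tuple of positive definite operators in $B(H)$, and let $\omega=(w_1,\dots,w_n)\in(0,1)^n$ with $\sum_{i=1}^n w_i=1$. Put $\Phi(\mathbb{A})=(\Phi(A_1),\dots,\Phi(A_n))$ and $h_0=\max_{1\le i,j\le n}R(A_i,A_j)^2$. Then $$\Phi(P_t(\omega;\mathbb{A}))\ \ge\ K\left(h_0,\tfrac12\right)^{\frac1t}\,P_t(\omega;\Phi(\mathbb{A})).$$
   Context: $B(H)$ is the set of bounded linear operators on $H$; $\le$ is the Loewner order on self-adjoint operators. "Positive definite" means positive and invertible with bounded inverse. A linear map $\Phi$ is positive if $X\ge0$ implies $\Phi(X)\ge 0$, and unital if $\Phi(I)=I$. For positive definite $A,B$ and $t\in(0,1]$, $A\sharp_t B=A^{1/2}(A^{-1/2}BA^{-1/2})^{t}A^{1/2}$. For positive definite $A,B$, $R(A,B)=\max\{r(A^{-1}B),r(B^{-1}A)\}$, where $r$ is the spectral radius; one has $r(B^{-1}A)=\inf\{\lambda>0: A\le\lambda B\}=\|B^{-1/2}AB^{-1/2}\|$. $K(h,\tfrac12)=\dfrac{2h^{1/4}}{1+h^{1/2}}$ for $h\ge1$. For $t\in(0,1]$, the weighted power mean $P_t(\omega;\mathbb{A})$ is the unique positive definite solution $X$ of the operator equation $X=\sum_{i=1}^n w_i\,(X\sharp_t A_i)$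 (existence and uniqueness are known). *)

theory Defs
  imports "HOL-Analysis.Analysis" "HOL-Computational_Algebra.Polynomial"
begin

section \<open>Complex Hilbert spaces\<close>

class complex_vector = real_vector +
  fixes scaleC :: "complex \<Rightarrow> 'a \<Rightarrow> 'a"  (infixr "*\<^sub>C" 75)
  assumes scaleC_add_right: "a *\<^sub>C (x + y) = a *\<^sub>C x + a *\<^sub>C y"
    and scaleC_add_left: "(a + b) *\<^sub>C x = a *\<^sub>C x + b *\<^sub>C x"
    and scaleC_scaleC [simp]: "a *\<^sub>C (b *\<^sub>C x) = (a * b) *\<^sub>C x"
    and scaleC_one [simp]: "1 *\<^sub>C x = x"
    and scaleR_scaleC: "r *\<^sub>R x = of_real r *\<^sub>C x"

text \<open>
  The complex inner product is linear in its second argument.  Its real part is the real inner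
  product of the superclass \<open>real_inner\<close>; positivity and definiteness of \<open>cinner\<close>, as well as
  \<open>norm x = sqrt (Re (cinner x x))\<close>, are thereby inherited.
\<close>

class complex_inner = complex_vector + real_inner +
  fixes cinner :: "'a \<Rightarrow> 'a \<Rightarrow> complex"
  assumes cinner_commute: "cinner x y = cnj (cinner y x)"
    and cinner_add_right: "cinner x (y + z) = cinner x y + cinner x z"
    and cinner_scaleC_right [simp]: "cinner x (c *\<^sub>C y) = c * cinner x y"
    and Re_cinner: "Re (cinner x y) = inner x y"

class chilbert_space = complex_inner + complete_space

instance chilbert_space \<subseteq> banach ..

class nonzero_chilbert_space = chilbert_space +
  assumes ex_nonzero: "\<exists>x. x \<noteq> 0"

lemma cinner_scaleC_left [simp]: "cinner (c *\<^sub>C x) y = cnj c * cinner x y"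
  by (metis cinner_commute cinner_scaleC_right complex_cnj_mult)

lemma cinner_add_left: "cinner (x + y) z = cinner x z + cinner y z"
  by (simp add: cinner_commute[of _ z] cinner_add_right)

lemma cinner_zero_right [simp]: "cinner x 0 = 0"
  using cinner_add_right[of x 0 0] by simp

lemma cinner_zero_left [simp]: "cinner 0 x = 0"
  using cinner_add_left[of 0 0 x] by simp

lemma cinner_self: "cinner x x = of_real ((norm x)\<^sup>2)"
proof (rule complex_eqI)
  show "Re (cinner x x) = Re (of_real ((norm x)\<^sup>2))"
    by (simp add: Re_cinner power2_norm_eq_inner)
  have "cinner x x = cnj (cinner x x)" by (rule cinner_commute)
  then show "Im (cinner x x) = Im (of_real ((norm x)\<^sup>2))"
    by (metis Im_complex_of_real Reals_cnj_iff complex_is_Real_iff)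
qed

lemma norm_scaleC [simp]: "norm (c *\<^sub>C (x::'a::complex_inner)) = cmod c * norm x"
proof -
  have "complex_of_real ((norm (c *\<^sub>C x))\<^sup>2) = (c * cnj c) * cinner x x"
    by (simp add: cinner_self[symmetric] mult_ac del: of_real_power)
  also have "\<dots> = of_real ((cmod c * norm x)\<^sup>2)"
    by (simp only: cinner_self complex_norm_square[symmetric] power_mult_distrib of_real_mult)
  finally have "complex_of_real ((norm (c *\<^sub>C x))\<^sup>2) = of_real ((cmod c * norm x)\<^sup>2)" .
  then have "(norm (c *\<^sub>C x))\<^sup>2 = (cmod c * norm x)\<^sup>2"
    by (simp only: of_real_eq_iff)
  then show ?thesis
    by (simp add: power2_eq_iff_nonneg)
qed

lemma bounded_linear_scaleC: "bounded_linear (\<lambda>x::'a::complex_inner. c *\<^sub>C x)"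
  by (rule bounded_linear_intro[where K = "cmod c"])
     (simp_all add: scaleC_add_right scaleR_scaleC mult_ac)

lemmas tendsto_scaleC = bounded_linear.tendsto[OF bounded_linear_scaleC]

section \<open>The algebra of bounded operators\<close>

typedef (overloaded) ('a::chilbert_space) operator =
  "{T :: 'a \<Rightarrow>\<^sub>L 'a. \<forall>c x. blinfun_apply T (c *\<^sub>C x) = c *\<^sub>C blinfun_apply T x}"
  morphisms blinfun_of Operator
  by (rule exI[of _ 0])
     (auto simp: bounded_linear.linear[OF bounded_linear_scaleC, THEN linear_0])

setup_lifting type_definition_operator

lift_definition app :: "'a::chilbert_space operator \<Rightarrow> 'a \<Rightarrow> 'a" is blinfun_apply .

lemma operator_eqI: "(\<And>x. app S x = app T x) \<Longrightarrow> S = T"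
  by transfer (rule blinfun_eqI)

lemma app_scaleC [simp]: "app T (c *\<^sub>C x) = c *\<^sub>C app T x"
  by transfer simp

instantiation operator :: (chilbert_space) real_normed_vector
begin

lift_definition zero_operator :: "'a operator" is 0
  by (auto simp: bounded_linear.linear[OF bounded_linear_scaleC, THEN linear_0])

lift_definition plus_operator :: "'a operator \<Rightarrow> 'a operator \<Rightarrow> 'a operator" is "(+)"
  by (simp add: blinfun.add_left scaleC_add_right)

lift_definition uminus_operator :: "'a operator \<Rightarrow> 'a operator" is uminus
  by (simp add: blinfun.minus_left
        bounded_linear.linear[OF bounded_linear_scaleC, THEN linear_neg])

lift_definition minus_operator :: "'a operator \<Rightarrow> 'a operator \<Rightarrow> 'a operator" is "(-)"
  by (simp add: blinfun.diff_left
        bounded_linear.linear[OF bounded_linear_scaleC, THEN linear_diff])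

lift_definition scaleR_operator :: "real \<Rightarrow> 'a operator \<Rightarrow> 'a operator" is scaleR
  by (simp add: blinfun.scaleR_left scaleR_scaleC mult_ac)

lift_definition norm_operator :: "'a operator \<Rightarrow> real" is norm .

lift_definition dist_operator :: "'a operator \<Rightarrow> 'a operator \<Rightarrow> real" is dist .

definition sgn_operator :: "'a operator \<Rightarrow> 'a operator"
  where "sgn_operator T = inverse (norm T) *\<^sub>R T"

definition uniformity_operator :: "('a operator \<times> 'a operator) filter"
  where "uniformity_operator = (INF e\<in>{0 <..}. principal {(S, T). dist S T < e})"

definition open_operator :: "'a operator set \<Rightarrow> bool"
  where "open_operator U \<longleftrightarrow> (\<forall>S\<in>U. \<forall>\<^sub>F (S', T) in uniformity. S' = S \<longrightarrow> T \<in> U)"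

instance
proof
  fix a b :: real and R S T :: "'a operator" and U :: "'a operator set"
  show "R + S + T = R + (S + T)" by transfer simp
  show "S + T = T + S" by transfer simp
  show "0 + T = T" by transfer simp
  show "- T + T = 0" by transfer simp
  show "S - T = S + - T" by transfer simp
  show "a *\<^sub>R (S + T) = a *\<^sub>R S + a *\<^sub>R T" by transfer (simp add: scaleR_add_right)
  show "(a + b) *\<^sub>R T = a *\<^sub>R T + b *\<^sub>R T" by transfer (simp add: scaleR_add_left)
  show "a *\<^sub>R b *\<^sub>R T = (a * b) *\<^sub>R T" by transfer simp
  show "1 *\<^sub>R T = T" by transfer simp
  show "dist S T = norm (S - T)" by transfer (rule dist_norm)
  show "sgn T = inverse (norm T) *\<^sub>R T" by (rule sgn_operator_def)
  show "uniformity = (INF e\<in>{0 <..}. principal {(S, T::'a operator). dist S T < e})"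
    by (rule uniformity_operator_def)
  show "open U \<longleftrightarrow> (\<forall>S\<in>U. \<forall>\<^sub>F (S', T) in uniformity. S' = S \<longrightarrow> T \<in> U)"
    by (rule open_operator_def)
  show "norm T = 0 \<longleftrightarrow> T = 0" by transfer simp
  show "norm (S + T) \<le> norm S + norm T" by transfer (rule norm_triangle_ineq)
  show "norm (a *\<^sub>R T) = \<bar>a\<bar> * norm T" by transfer simp
qed

end

lemma app_add [simp]: "app (S + T) x = app S x + app T x"
  by transfer (rule blinfun.add_left)

lemma app_diff [simp]: "app (S - T) x = app S x - app T x"
  by transfer (rule blinfun.diff_left)

lemma app_zero [simp]: "app 0 x = 0"
  by transfer simp

lemma app_scaleR [simp]: "app (r *\<^sub>R T) x = r *\<^sub>R app T x"
  by transfer (rule blinfun.scaleR_left)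

lemma bounded_linear_app: "bounded_linear (app T)"
  by transfer (rule blinfun.bounded_linear_right)

instantiation operator :: (chilbert_space) complex_vector
begin

lift_definition scaleC_operator :: "complex \<Rightarrow> 'a operator \<Rightarrow> 'a operator"
  is "\<lambda>c T. Blinfun (\<lambda>x. c *\<^sub>C x) o\<^sub>L T"
  by (simp add: bounded_linear_Blinfun_apply[OF bounded_linear_scaleC] mult_ac)

lemma app_cscale [simp]: "app (c *\<^sub>C T) x = c *\<^sub>C app T x"
  by transfer (simp add: bounded_linear_Blinfun_apply[OF bounded_linear_scaleC])

instance
  by standard (auto intro!: operator_eqI simp: scaleC_add_right scaleC_add_left scaleR_scaleC)

end

instantiation operator :: (chilbert_space) "{one, times}"
begin

lift_definition one_operator :: "'a operator" is id_blinfun by simp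

lift_definition times_operator :: "'a operator \<Rightarrow> 'a operator \<Rightarrow> 'a operator" is "(o\<^sub>L)" by simp

instance ..

end

lemma app_one [simp]: "app 1 x = x"
  by transfer simp

lemma app_mult [simp]: "app (S * T) x = app S (app T x)"
  by transfer simp

instance operator :: (chilbert_space) "{monoid_mult, real_normed_algebra}"
proof
  fix a :: real and R S T :: "'a operator"
  note add = bounded_linear.linear[OF bounded_linear_app, THEN linear_add]
    and scale = bounded_linear.linear[OF bounded_linear_app, THEN linear_scale]
  show "R * S * T = R * (S * T)" by (rule operator_eqI) simp
  show "1 * T = T" "T * 1 = T" by (auto intro: operator_eqI)
  show "(R + S) * T = R * T + S * T" by (rule operator_eqI) simp
  show "R * (S + T) = R * S + R * T" by (rule operator_eqI) (simp add: add)
  show "(a *\<^sub>R S) * T = a *\<^sub>R (S * T)" by (rule operator_eqI) simp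
  show "S * (a *\<^sub>R T) = a *\<^sub>R (S * T)" by (rule operator_eqI) (simp add: scale)
  show "norm (S * T) \<le> norm S * norm T" by transfer (rule norm_blinfun_compose)
qed

instance operator :: (nonzero_chilbert_space) real_normed_algebra_1
proof
  obtain x :: 'a where x: "x \<noteq> 0" using ex_nonzero by blast
  show "(0 :: 'a operator) \<noteq> 1"
  proof
    assume "(0 :: 'a operator) = 1"
    then have "app 0 x = app 1 x" by simp
    with x show False by simp
  qed
  have "norm (app 1 x) \<le> norm (1 :: 'a operator) * norm x"
    by transfer (rule norm_blinfun)
  with x have "1 \<le> norm (1 :: 'a operator)" by simp
  moreover have "norm (1 :: 'a operator) \<le> 1"
    by transfer (simp add: norm_blinfun_bound)
  ultimately show "norm (1 :: 'a operator) = 1" by simp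
qed

instance operator :: (chilbert_space) banach
proof
  fix X :: "nat \<Rightarrow> 'a operator" assume "Cauchy X"
  then have "Cauchy (\<lambda>n. blinfun_of (X n))"
    by (simp add: Cauchy_def dist_operator.rep_eq)
  then obtain L where L: "(\<lambda>n. blinfun_of (X n)) \<longlonglongrightarrow> L"
    by (auto dest!: Cauchy_convergent simp: convergent_def)
  have lim: "(\<lambda>n. app (X n) x) \<longlonglongrightarrow> blinfun_apply L x" for x
    unfolding app.rep_eq by (intro tendsto_intros L)
  have "blinfun_apply L (c *\<^sub>C x) = c *\<^sub>C blinfun_apply L x" for c x
    using LIMSEQ_unique[OF lim[of "c *\<^sub>C x"]] tendsto_scaleC[OF lim[of x], of c] by simp
  then have "blinfun_of (Operator L) = L" by (simp add: Operator_inverse)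
  with L have "X \<longlonglongrightarrow> Operator L"
    by (simp add: tendsto_iff dist_operator.rep_eq)
  then show "convergent X" by (rule convergentI)
qed

section \<open>The Loewner order\<close>

definition selfadjoint :: "'a::chilbert_space operator \<Rightarrow> bool"
  where "selfadjoint T \<longleftrightarrow> (\<forall>x y. cinner (app T x) y = cinner x (app T y))"

definition positive :: "'a::chilbert_space operator \<Rightarrow> bool"
  where "positive T \<longleftrightarrow> selfadjoint T \<and> (\<forall>x. 0 \<le> Re (cinner x (app T x)))"

lemma selfadjoint_add: "selfadjoint S \<Longrightarrow> selfadjoint T \<Longrightarrow> selfadjoint (S + T)"
  by (simp add: selfadjoint_def cinner_add_left cinner_add_right)

instantiation operator :: (chilbert_space) order
begin

definition less_eq_operator :: "'a operator \<Rightarrow> 'a operator \<Rightarrow> bool"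
  where "S \<le> T \<longleftrightarrow> positive (T - S)"

definition less_operator :: "'a operator \<Rightarrow> 'a operator \<Rightarrow> bool"
  where "S < T \<longleftrightarrow> S \<le> T \<and> \<not> T \<le> (S :: 'a operator)"

instance
proof
  fix R S T :: "'a operator"
  show "S < T \<longleftrightarrow> S \<le> T \<and> \<not> T \<le> S" by (rule less_operator_def)
  show "T \<le> T"
    by (simp add: less_eq_operator_def positive_def selfadjoint_def)
  show "R \<le> T" if "R \<le> S" "S \<le> T"
  proof -
    have "selfadjoint ((S - R) + (T - S))"
      using that by (intro selfadjoint_add) (auto simp: less_eq_operator_def positive_def)
    moreover have "0 \<le> inner x (app (T - R) x)" for x
    proof -
      have "0 \<le> inner x (app (S - R) x) + inner x (app (T - S) x)"
        using that by (intro add_nonneg_nonneg)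
          (auto simp: less_eq_operator_def positive_def Re_cinner simp del: app_diff)
      then show ?thesis by (simp add: inner_diff_right)
    qed
    ultimately show ?thesis
      by (simp add: less_eq_operator_def positive_def Re_cinner)
  qed
  show "S = T" if "S \<le> T" "T \<le> S"
  proof (rule operator_eqI)
    fix x
    define D where "D = T - S"
    have "0 \<le> inner z (app (T - S) z)" "0 \<le> inner z (app (S - T) z)" for z
      using that by (simp_all add: less_eq_operator_def positive_def Re_cinner del: app_diff)
    then have form: "inner z (app D z) = 0" for z
      unfolding D_def app_diff inner_diff_right by (simp add: order_antisym)
    have sym: "inner (app D y) z = inner y (app D z)" for y z
      using that(1) unfolding less_eq_operator_def positive_def selfadjoint_def D_def
      by (simp add: Re_cinner[symmetric] del: app_diff)
    have "inner (x + app D x) (app D (x + app D x)) = 2 * inner (app D x) (app D x)"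
      using form[of x] form[of "app D x"] sym[of x "app D x"]
      by (simp add: bounded_linear.linear[OF bounded_linear_app, THEN linear_add]
          inner_add_left inner_add_right)
    then have "app D x = 0" using form by simp
    then show "app S x = app T x" by (simp add: D_def)
  qed
qed

end

section \<open>Spectrum and functional calculus\<close>

definition op_invertible :: "'a::chilbert_space operator \<Rightarrow> bool"
  where "op_invertible T \<longleftrightarrow> (\<exists>S. S * T = 1 \<and> T * S = 1)"

definition op_inverse :: "'a::chilbert_space operator \<Rightarrow> 'a operator"
  where "op_inverse T = (THE S. S * T = 1 \<and> T * S = 1)"

definition posdef :: "'a::chilbert_space operator \<Rightarrow> bool"
  where "posdef T \<longleftrightarrow> 0 \<le> T \<and> op_invertible T"

definition spectrum :: "'a::chilbert_space operator \<Rightarrow> complex set"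
  where "spectrum T = {c. \<not> op_invertible (T - c *\<^sub>C 1)}"

definition spectral_radius :: "'a::chilbert_space operator \<Rightarrow> real"
  where "spectral_radius T = Sup (cmod ` spectrum T)"

definition poly_op :: "real poly \<Rightarrow> 'a::chilbert_space operator \<Rightarrow> 'a operator"
  where "poly_op p T = (\<Sum>i\<le>degree p. coeff p i *\<^sub>R T ^ i)"

text \<open>
  Continuous functional calculus for a self-adjoint \<open>T\<close> and a real function \<open>f\<close> that is continuous
  on the spectrum: \<open>f(T)\<close> is the norm limit of \<open>p\<^sub>n(T)\<close> for polynomials \<open>p\<^sub>n\<close> converging to \<open>f\<close>
  uniformly on the (real) spectrum of \<open>T\<close>.
\<close>

definition cfc :: "(real \<Rightarrow> real) \<Rightarrow> 'a::chilbert_space operator \<Rightarrow> 'a operator"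
  where "cfc f T = (THE S. \<exists>p. uniform_limit {x. complex_of_real x \<in> spectrum T}
                                  (\<lambda>n x. poly (p n) x) f sequentially
                              \<and> (\<lambda>n. poly_op (p n) T) \<longlonglongrightarrow> S)"

definition op_powr :: "'a::chilbert_space operator \<Rightarrow> real \<Rightarrow> 'a operator"
  where "op_powr T s = cfc (\<lambda>x. x powr s) T"

section \<open>Weighted geometric means and power means\<close>

definition geo_mean :: "real \<Rightarrow> 'a::chilbert_space operator \<Rightarrow> 'a operator \<Rightarrow> 'a operator"
  where "geo_mean t A B =
    op_powr A (1/2) * op_powr (op_powr A (-1/2) * B * op_powr A (-1/2)) t * op_powr A (1/2)"

text \<open>The \<open>n\<close>-tuples \<open>w\<close> and \<open>A\<close> are functions of which only the values on \<open>{1..n}\<close> matter.\<close>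

definition power_mean ::
    "nat \<Rightarrow> real \<Rightarrow> (nat \<Rightarrow> real) \<Rightarrow> (nat \<Rightarrow> 'a::chilbert_space operator) \<Rightarrow> 'a operator"
  where "power_mean n t w A =
    (THE X. posdef X \<and> X = (\<Sum>i=1..n. w i *\<^sub>R geo_mean t X (A i)))"

definition ratio_bound :: "'a::chilbert_space operator \<Rightarrow> 'a operator \<Rightarrow> real"
  where "ratio_bound A B =
    max (spectral_radius (op_inverse A * B)) (spectral_radius (op_inverse B * A))"

text \<open>The generalized Kantorovich constant \<open>K(h, p)\<close> at \<open>p = 1/2\<close>, for \<open>h \<ge> 1\<close>.\<close>

definition kantorovich_half :: "real \<Rightarrow> real"
  where "kantorovich_half h = 2 * h powr (1/4) / (1 + h powr (1/2))"

definition complex_linear :: "('a::complex_vector \<Rightarrow> 'b::complex_vector) \<Rightarrow> bool"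
  where "complex_linear \<Phi> \<longleftrightarrow>
    (\<forall>x y. \<Phi> (x + y) = \<Phi> x + \<Phi> y) \<and> (\<forall>c x. \<Phi> (c *\<^sub>C x) = c *\<^sub>C \<Phi> x)"

definition positive_map ::
    "('a::chilbert_space operator \<Rightarrow> 'b::chilbert_space operator) \<Rightarrow> bool"
  where "positive_map \<Phi> \<longleftrightarrow> complex_linear \<Phi> \<and> (\<forall>X. 0 \<le> X \<longrightarrow> 0 \<le> \<Phi> X)"

end

theory Submission
  imports Defs "HOL-Computational_Algebra.Fundamental_Theorem_Algebra"
begin

text \<open>
  Write \<open>F X = (\<Sum>i. w\<^sub>i (X \<sharp>\<^sub>t A\<^sub>i))\<close>, so that the power mean \<open>P\<close> is the fixed point of \<open>F\<close>, and let
  \<open>G\<close> be the corresponding map for the tuple \<open>\<Phi>(A\<^sub>i)\<close>, with fixed point \<open>Q\<close>.  Both maps are monotone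
  on positive definite operators and homogeneous of degree \<open>1 - t < 1\<close>.  These two properties give
  a comparison principle (\<open>subsolution_le_supersolution\<close>): \<open>Q \<le> G Q\<close> and \<open>G Z \<le> Z\<close> imply
  \<open>Q \<le> Z\<close>, because each application of \<open>G\<close> to \<open>\<alpha> Q \<le> Z\<close> improves the factor \<open>\<alpha>\<close> to
  \<open>\<alpha>\<^bsup>1-t\<^esup>\<close>.  Uniqueness of the fixed point is a special case, and existence follows by monotone
  iteration from below and from above.

  Put \<open>\<rho> = sqrt h\<^sub>0\<close> and let \<open>K\<close> be the Kantorovich constant.  Since \<open>A\<^sub>j \<le> \<rho> A\<^sub>i\<close> for all
  \<open>i\<close> and \<open>j\<close>, the operator \<open>\<rho> A\<^sub>i\<close> is a supersolution for \<open>F\<close> and \<open>A\<^sub>i / \<rho>\<close> a subsolution, so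
  \<open>P\<close> lies between them.  Under such bounds a unital positive map satisfies the reverse
  of Ando's inequality, \<open>\<Phi>(P \<sharp>\<^sub>t A\<^sub>i) \<ge> K (\<Phi>(P) \<sharp>\<^sub>t \<Phi>(A\<^sub>i))\<close> (\<open>positive_map_geo_mean_ge\<close>): on
  \<open>[1/\<rho>, \<rho>]\<close> the chord of \<open>x\<^sup>t\<close> separates \<open>x\<^sup>t\<close> from \<open>K x\<^sup>t\<close>, and \<open>\<Phi>\<close> preserves affine
  expressions.  Summation gives \<open>\<Phi>(P) \<ge> K G(\<Phi>(P))\<close>.  By homogeneity \<open>Z = K\<^bsup>-1/t\<^esup> \<Phi>(P)\<close> satisfies
  \<open>G Z \<le> Z\<close>, and the comparison principle yields \<open>Q \<le> Z\<close>, which is the claim.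

  Monotonicity of \<open>X \<sharp>\<^sub>t A\<close> in \<open>X\<close> rests on the identity \<open>X \<sharp>\<^sub>t A = A \<sharp>\<^sub>1\<^sub>-\<^sub>t X\<close>
  (\<open>geo_mean_swap\<close>) and the Loewner--Heinz inequality (\<open>op_powr_mono\<close>).  The functional calculus
  underneath is controlled by one fact: a real polynomial that is nonnegative on the real spectrum
  of a self-adjoint \<open>T\<close> is nonnegative at \<open>T\<close> (\<open>poly_op_nonneg\<close>).
\<close>

section \<open>Self-adjoint operators and the Loewner order\<close>

lemma app_add_right [simp]: "app T (x + y) = app T x + app T y"
  and app_diff_right [simp]: "app T (x - y) = app T x - app T y"
  and app_scaleR_right [simp]: "app T (r *\<^sub>R x) = r *\<^sub>R app T x"
  and app_zero_right [simp]: "app T 0 = 0"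
  and app_minus [simp]: "app (- T) x = - app T x"
  using bounded_linear.linear[OF bounded_linear_app, of T]
  app_diff[of 0 T x]
  by (auto simp: linear_add linear_diff linear_scale linear_0 simp del: app_diff)

lemma mult_scaleC_right: "S * (c *\<^sub>C T) = c *\<^sub>C (S * T)"
  and mult_scaleC_left: "(c *\<^sub>C S) * T = c *\<^sub>C (S * T)"
  for S T :: "'a::chilbert_space operator"
  by (auto intro: operator_eqI)

text \<open>The imaginary part of the complex inner product is recovered from its real part by
  multiplying a vector by \<open>\<i>\<close>; this reduces self-adjointness to the real inner product.\<close>

lemma Im_cinner: "Im (cinner x y) = - inner x (\<i> *\<^sub>C y)"
  by (simp add: Re_cinner[symmetric])

lemma selfadjoint_iff: "selfadjoint T \<longleftrightarrow> (\<forall>x y. inner (app T x) y = inner x (app T y))"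
proof
  assume "selfadjoint T"
  then show "\<forall>x y. inner (app T x) y = inner x (app T y)"
    by (metis Re_cinner selfadjoint_def)
next
  assume *: "\<forall>x y. inner (app T x) y = inner x (app T y)"
  show "selfadjoint T"
    unfolding selfadjoint_def complex_eq_iff Re_cinner Im_cinner
    using * by (metis app_scaleC)
qed

lemma selfadjointD: "selfadjoint T \<Longrightarrow> inner (app T x) y = inner x (app T y)"
  by (simp add: selfadjoint_iff)

lemma selfadjoint_zero [simp]: "selfadjoint 0"
  and selfadjoint_one [simp]: "selfadjoint 1"
  and selfadjoint_diff: "selfadjoint S \<Longrightarrow> selfadjoint T \<Longrightarrow> selfadjoint (S - T)"
  and selfadjoint_scaleR: "selfadjoint T \<Longrightarrow> selfadjoint (r *\<^sub>R T)"
  and selfadjoint_conj: "selfadjoint V \<Longrightarrow> selfadjoint T \<Longrightarrow> selfadjoint (V * T * V)"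
  by (simp_all add: selfadjoint_iff inner_diff_left inner_diff_right)

lemma selfadjoint_mult_commute:
  "selfadjoint S \<Longrightarrow> selfadjoint T \<Longrightarrow> S * T = T * S \<Longrightarrow> selfadjoint (S * T)"
  by (metis app_mult selfadjoint_iff)

lemma le_iff_inner:
  "S \<le> T \<longleftrightarrow> selfadjoint (T - S) \<and> (\<forall>x. inner x (app S x) \<le> inner x (app T x))"
  by (auto simp: less_eq_operator_def positive_def Re_cinner inner_diff_right)

lemma leD_inner: "S \<le> T \<Longrightarrow> inner x (app S x) \<le> inner x (app T x)"
  by (simp add: le_iff_inner)

lemma leI_inner:
  "selfadjoint S \<Longrightarrow> selfadjoint T \<Longrightarrow> (\<And>x. inner x (app S x) \<le> inner x (app T x)) \<Longrightarrow> S \<le> T"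
  by (simp add: le_iff_inner selfadjoint_diff)

lemma selfadjoint_le_iff: "S \<le> T \<Longrightarrow> selfadjoint S \<longleftrightarrow> selfadjoint T"
  by (metis add.commute diff_add_cancel le_iff_inner selfadjoint_add selfadjoint_diff
      minus_diff_eq diff_diff_eq2 add_diff_cancel_left')

lemma selfadjoint_nonneg: "0 \<le> T \<Longrightarrow> selfadjoint T"
  using selfadjoint_le_iff[of 0 T] by simp

instance operator :: (chilbert_space) ordered_real_vector
proof
  fix S T R :: "'a operator" and a b :: real
  show "S \<le> T \<Longrightarrow> R + S \<le> R + T"
    by (simp add: less_eq_operator_def)
  show "S \<le> T \<Longrightarrow> 0 \<le> a \<Longrightarrow> a *\<^sub>R S \<le> a *\<^sub>R T"
    using selfadjoint_scaleR[of "T - S" a]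
    by (auto simp: le_iff_inner scaleR_diff_right mult_left_mono)
  show "a \<le> b \<Longrightarrow> 0 \<le> S \<Longrightarrow> a *\<^sub>R S \<le> b *\<^sub>R S"
    using selfadjoint_scaleR[of S "b - a"]
    by (auto simp: le_iff_inner scaleR_diff_left mult_right_mono)
qed

lemma conj_mono:
  fixes S :: "'a::chilbert_space operator"
  assumes "selfadjoint V" "S \<le> T" shows "V * S * V \<le> V * T * V"
proof -
  have "V * T * V - V * S * V = V * (T - S) * V"
    by (simp add: algebra_simps)
  moreover have "positive (V * (T - S) * V)"
    using assms unfolding less_eq_operator_def positive_def
    by (simp add: selfadjoint_conj Re_cinner selfadjointD[OF assms(1), symmetric]
        del: app_diff)
  ultimately show ?thesis by (simp add: less_eq_operator_def)
qed

lemma zero_le_one_op [simp]: "(0::'a::chilbert_space operator) \<le> 1"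
  by (simp add: le_iff_inner)

lemma scaleR_one_mono: "a \<le> b \<Longrightarrow> a *\<^sub>R (1::'a::chilbert_space operator) \<le> b *\<^sub>R 1"
  by (simp add: scaleR_right_mono)

lemma tendsto_app: "X \<longlonglongrightarrow> S \<Longrightarrow> (\<lambda>n. app (X n) x) \<longlonglongrightarrow> app S x"
proof -
  have "bounded_linear (\<lambda>T. app T x)"
  proof (rule bounded_linear_intro[where K = "norm x"])
    show "norm (app T x) \<le> norm T * norm x" for T
      by transfer (rule norm_blinfun)
  qed auto
  then show "X \<longlonglongrightarrow> S \<Longrightarrow> ?thesis" by (rule bounded_linear.tendsto)
qed

lemma selfadjoint_tendsto:
  assumes "X \<longlonglongrightarrow> S" "\<And>n. selfadjoint (X n)" shows "selfadjoint S"
  unfolding selfadjoint_iff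
proof (intro allI)
  fix x y
  show "inner (app S x) y = inner x (app S y)"
  proof (rule LIMSEQ_unique)
    show "(\<lambda>n. inner (app (X n) x) y) \<longlonglongrightarrow> inner (app S x) y"
      by (intro tendsto_inner tendsto_const tendsto_app assms)
    have "(\<lambda>n. inner (app (X n) x) y) = (\<lambda>n. inner x (app (X n) y))"
      by (intro ext selfadjointD assms(2))
    then show "(\<lambda>n. inner (app (X n) x) y) \<longlonglongrightarrow> inner x (app S y)"
      by (simp only:) (intro tendsto_inner tendsto_const tendsto_app assms)
  qed
qed

lemma op_tendsto_le:
  fixes S T :: "'a::chilbert_space operator"
  assumes "X \<longlonglongrightarrow> S" "Y \<longlonglongrightarrow> T" "\<And>n. X n \<le> Y n"
  shows "S \<le> T"
  unfolding le_iff_inner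
proof (intro conjI allI)
  show "selfadjoint (T - S)"
    by (rule selfadjoint_tendsto[OF tendsto_diff[OF assms(2,1)]])
      (use assms(3) in \<open>simp add: le_iff_inner\<close>)
  show "inner x (app S x) \<le> inner x (app T x)" for x
  proof (rule LIMSEQ_le)
    show "(\<lambda>n. inner x (app (X n) x)) \<longlonglongrightarrow> inner x (app S x)"
      by (intro tendsto_inner tendsto_const tendsto_app assms)
    show "(\<lambda>n. inner x (app (Y n) x)) \<longlonglongrightarrow> inner x (app T x)"
      by (intro tendsto_inner tendsto_const tendsto_app assms)
  qed (use assms(3) in \<open>auto intro: leD_inner\<close>)
qed

section \<open>The operator norm and the order\<close>

lemma norm_app_le: "norm (app T x) \<le> norm T * norm x"
  by transfer (rule norm_blinfun)

lemma op_norm_leI: "0 \<le> c \<Longrightarrow> (\<And>x. norm (app T x) \<le> c * norm x) \<Longrightarrow> norm T \<le> c"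
  by transfer (rule norm_blinfun_bound)

lemma le_norm: "selfadjoint T \<Longrightarrow> T \<le> norm T *\<^sub>R 1"
  and minus_norm_le: "selfadjoint T \<Longrightarrow> (- norm T) *\<^sub>R 1 \<le> T"
proof -
  have *: "\<bar>inner x (app T x)\<bar> \<le> norm T * inner x x" for x
    using order_trans[OF Cauchy_Schwarz_ineq2 mult_left_mono[OF norm_app_le norm_ge_zero]]
    by (simp add: mult_ac dot_square_norm power2_eq_square)
  show "T \<le> norm T *\<^sub>R 1" if "selfadjoint T"
    using abs_le_D1[OF *] that by (intro leI_inner) (auto intro: selfadjoint_scaleR)
  show "(- norm T) *\<^sub>R 1 \<le> T" if "selfadjoint T"
  proof (intro leI_inner)
    show "inner x (app ((- norm T) *\<^sub>R 1) x) \<le> inner x (app T x)" for x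
      using abs_le_D2[OF *, of x] by simp
  qed (use that in \<open>auto intro!: selfadjoint_scaleR simp del: scaleR_minus_left\<close>)
qed

text \<open>Polarisation: \<open>4 \<langle>Sx, y\<rangle>\<close> is the difference of the quadratic form at \<open>x + y\<close> and \<open>x - y\<close>,
  so a two-sided bound on the form bounds \<open>\<langle>Sx, y\<rangle>\<close>; take \<open>y\<close> proportional to \<open>S x\<close>.\<close>

lemma norm_le_of_bounds:
  fixes S :: "'a::chilbert_space operator"
  assumes "(- c) *\<^sub>R 1 \<le> S" "S \<le> c *\<^sub>R 1" "0 < c"
  shows "norm S \<le> c"
proof (rule op_norm_leI)
  fix x
  have sa: "selfadjoint S"
    using selfadjoint_le_iff[OF assms(2)] by (simp add: selfadjoint_scaleR)
  define y where "y = (1/c) *\<^sub>R app S x"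
  have sym: "inner x (app S y) = inner (app S x) y" "inner y (app S x) = inner (app S x) y"
    using selfadjointD[OF sa] by (simp_all add: inner_commute)
  have "4 * inner (app S x) y
      = inner (x + y) (app S (x + y)) - inner (x - y) (app S (x - y))"
    by (simp add: inner_add_left inner_add_right inner_diff_left inner_diff_right sym)
  also have "\<dots> \<le> c * inner (x + y) (x + y) + c * inner (x - y) (x - y)"
  proof -
    have "inner (x + y) (app S (x + y)) \<le> c * inner (x + y) (x + y)"
      using leD_inner[OF assms(2), of "x + y"]
      by (simp only: app_scaleR app_one inner_scaleR_right)
    moreover have "- c * inner (x - y) (x - y) \<le> inner (x - y) (app S (x - y))"
      using leD_inner[OF assms(1), of "x - y"]
      by (simp only: app_scaleR app_one inner_scaleR_right)
    ultimately show ?thesis by linarith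
  qed
  also have "\<dots> = 2 * c * (inner x x + inner y y)"
    by (simp add: inner_add_left inner_add_right inner_diff_left inner_diff_right
        algebra_simps)
  finally have "4 * (norm (app S x))\<^sup>2 / c \<le> 2 * c * (norm x)\<^sup>2 + 2 * (norm (app S x))\<^sup>2 / c"
    using assms(3) by (simp add: y_def dot_square_norm field_simps power2_eq_square)
  then have "(norm (app S x))\<^sup>2 / c \<le> c * (norm x)\<^sup>2" by simp
  then have "(norm (app S x))\<^sup>2 \<le> c * (norm x)\<^sup>2 * c"
    using assms(3) by (simp only: pos_divide_le_eq)
  then have "(norm (app S x))\<^sup>2 \<le> (c * norm x)\<^sup>2"
    by (simp add: power2_eq_square mult_ac)
  then show "norm (app S x) \<le> c * norm x"
    by (rule power2_le_imp_le) (use assms(3) in simp)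
qed (use assms in simp)

lemma norm_le_of_between:
  fixes S :: "'a::chilbert_space operator"
  assumes "0 \<le> S" "S \<le> c *\<^sub>R 1" "0 < c"
  shows "norm S \<le> c"
proof (rule norm_le_of_bounds)
  have "(- c) *\<^sub>R (1::'a operator) \<le> 0 *\<^sub>R 1"
    by (rule scaleR_one_mono) (use assms in simp)
  also have "0 *\<^sub>R (1::'a operator) \<le> S" using assms(1) by simp
  finally show "(- c) *\<^sub>R 1 \<le> S" .
qed (rule assms)+

lemma norm_mono_op:
  fixes S T :: "'a::chilbert_space operator"
  assumes "0 \<le> S" "S \<le> T" shows "norm S \<le> norm T"
proof (cases "norm T = 0")
  case True
  with assms show ?thesis by (simp add: order_antisym)
next
  case False
  have "T \<le> norm T *\<^sub>R 1"
    using assms by (intro le_norm selfadjoint_nonneg) simp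
  with assms(2) have "S \<le> norm T *\<^sub>R 1" by (rule order_trans)
  with assms(1) show ?thesis by (rule norm_le_of_between) (use False in simp)
qed

text \<open>Expand \<open>0 \<le> \<langle>x - y, D(x - y)\<rangle>\<close> for \<open>y = D x / c\<close>, a Cauchy--Schwarz argument for the form
  of \<open>D\<close>.\<close>

lemma norm_app_square_le:
  fixes D :: "'a::chilbert_space operator"
  assumes "0 \<le> D" "D \<le> c *\<^sub>R 1" "0 < c"
  shows "(norm (app D x))\<^sup>2 \<le> c * inner x (app D x)"
proof -
  have sa: "selfadjoint D" using assms(1) by (rule selfadjoint_nonneg)
  define y where "y = (1/c) *\<^sub>R app D x"
  have yy: "inner y (app D y) \<le> (norm (app D x))\<^sup>2 / c"
    using leD_inner[OF assms(2), of y] assms(3)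
    by (simp add: y_def dot_square_norm power2_eq_square field_simps)
  have xy: "inner y (app D x) = (norm (app D x))\<^sup>2 / c" "inner x (app D y) = (norm (app D x))\<^sup>2 / c"
    using selfadjointD[OF sa, of x "app D x"] by (simp_all add: y_def dot_square_norm)
  have "0 \<le> inner (x - y) (app D (x - y))"
    using leD_inner[OF assms(1), of "x - y"] by (simp del: app_diff_right)
  also have "\<dots> = inner x (app D x) - 2 * (norm (app D x))\<^sup>2 / c + inner y (app D y)"
    using xy by (simp add: inner_diff_left inner_diff_right)
  also have "\<dots> \<le> inner x (app D x) - (norm (app D x))\<^sup>2 / c"
    using yy by simp
  finally show ?thesis using assms(3) by (simp add: field_simps)
qed

section \<open>Invertibility and the real spectrum\<close>

lemma op_invertibleI: "S * T = 1 \<Longrightarrow> T * S = 1 \<Longrightarrow> op_invertible T"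
  by (auto simp: op_invertible_def)

lemma op_inverse_eqI:
  fixes S T :: "'a::chilbert_space operator"
  assumes "S * T = 1" "T * S = 1" shows "op_inverse T = S"
  unfolding op_inverse_def
proof (rule the_equality)
  fix R :: "'a operator" assume "R * T = 1 \<and> T * R = 1"
  then show "R = S" using assms by (metis mult.assoc mult_1 mult_1_right)
qed (use assms in auto)

lemma op_inverse_works:
  "op_invertible T \<Longrightarrow> op_inverse T * T = 1" "op_invertible T \<Longrightarrow> T * op_inverse T = 1"
  using op_inverse_eqI by (auto simp: op_invertible_def)

lemma op_invertible_mult:
  assumes "op_invertible S" "op_invertible T" shows "op_invertible (S * T)"
proof (rule op_invertibleI)
  show "(op_inverse T * op_inverse S) * (S * T) = 1"
    using op_inverse_works[OF assms(1)] op_inverse_works[OF assms(2)]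
    by (metis mult.assoc mult_1)
  show "(S * T) * (op_inverse T * op_inverse S) = 1"
    using op_inverse_works[OF assms(1)] op_inverse_works[OF assms(2)]
    by (metis mult.assoc mult_1)
qed

lemma op_invertible_commute_factor:
  fixes S T :: "'a::chilbert_space operator"
  assumes "op_invertible (S * T)" "S * T = T * S" shows "op_invertible S"
proof -
  obtain R where R: "R * (S * T) = 1" "(S * T) * R = 1"
    using assms(1) by (auto simp: op_invertible_def)
  have "S * (T * R) = 1" "(R * T) * S = 1"
    using R(2) R(1)[unfolded assms(2)] by (simp_all add: mult.assoc)
  moreover from this have "T * R = R * T" by (metis mult.assoc mult_1 mult_1_right)
  ultimately show ?thesis by (intro op_invertibleI[of "R * T"]) auto
qed

lemma op_invertible_scaleR:
  assumes "op_invertible T" "r \<noteq> 0" shows "op_invertible (r *\<^sub>R T)"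
  using op_inverse_works[OF assms(1)] assms(2)
  by (intro op_invertibleI[of "(1/r) *\<^sub>R op_inverse T"]) auto

text \<open>The inverse is the sum of the Neumann series \<open>\<Sum>k. R\<^sup>k\<close>.\<close>

lemma op_invertible_one_minus:
  fixes R :: "'a::nonzero_chilbert_space operator"
  assumes "norm R < 1" shows "op_invertible (1 - R)"
proof -
  define S where "S = (\<Sum>k. R ^ k)"
  have sm: "summable (\<lambda>k. R ^ k)" by (rule complete_algebra_summable_geometric[OF assms])
  have S: "S = 1 + (\<Sum>k. R ^ Suc k)"
    unfolding S_def using suminf_split_head[OF sm] by simp
  have "(\<Sum>k. R ^ Suc k) = R * S"
    using suminf_mult[OF sm, of R] by (simp add: S_def)
  moreover have "(\<Sum>k. R ^ Suc k) = S * R"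
    using suminf_mult2[OF sm, of R] by (simp add: S_def power_commutes)
  ultimately show ?thesis using S
    by (intro op_invertibleI[of S]) (simp_all add: algebra_simps)
qed

text \<open>For \<open>N\<close> at least \<open>\<parallel>D\<parallel>\<close>, the bounds \<open>c \<le> D \<le> N\<close> make \<open>1 - D/N\<close> a strict contraction.  The bound
  \<open>c/2\<close> in place of \<open>c\<close> keeps the estimate of its norm positive.\<close>

lemma op_invertible_of_lower_bound:
  fixes D :: "'a::nonzero_chilbert_space operator"
  assumes "c *\<^sub>R 1 \<le> D" "0 < c" shows "op_invertible D"
proof -
  have sa: "selfadjoint D"
    using selfadjoint_le_iff[OF assms(1)] by (simp add: selfadjoint_scaleR)
  define N where "N = norm D + c"
  have N: "0 < N" "norm D \<le> N" using assms(2) by (auto simp: N_def add_nonneg_pos)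
  have DN: "D \<le> N *\<^sub>R 1"
    using le_norm[OF sa] scaleR_one_mono[OF N(2)] by (rule order_trans)
  define R where "R = (1/N) *\<^sub>R (N *\<^sub>R 1 - D)"
  have "0 \<le> R"
    unfolding R_def using DN N(1) by (intro scaleR_nonneg_nonneg) auto
  moreover have "R \<le> (1/N) *\<^sub>R (N *\<^sub>R 1 - c *\<^sub>R 1)"
    unfolding R_def using assms(1) N(1) by (intro scaleR_left_mono) auto
  then have "R \<le> ((N - c) / N) *\<^sub>R 1"
    by (simp add: scaleR_diff_left[symmetric] )
  then have "R \<le> ((N - c/2) / N) *\<^sub>R 1"
    by (rule order_trans) (use assms(2) N(1) in \<open>auto intro!: scaleR_one_mono divide_right_mono\<close>)
  moreover have "0 < N - c/2" using assms(2) norm_ge_zero[of D] unfolding N_def by linarith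
  then have "0 < (N - c/2)/N" using N by simp
  ultimately have "norm R \<le> (N - c/2)/N" by (rule norm_le_of_between)
  also have "\<dots> < 1" using assms(2) N(1) by simp
  finally have "op_invertible (N *\<^sub>R (1 - R))"
    using N(1) by (intro op_invertible_scaleR op_invertible_one_minus) auto
  also have "N *\<^sub>R (1 - R) = D"
    using N(1) by (simp add: R_def scaleR_diff_right)
  finally show ?thesis .
qed

text \<open>By \<open>norm_app_square_le\<close> a small value of the form at \<open>x\<close> makes \<open>D x\<close> small, which a bounded
  inverse allows only if \<open>x\<close> is small.\<close>

lemma lower_bound_of_op_invertible:
  fixes D :: "'a::nonzero_chilbert_space operator"
  assumes "0 \<le> D" "op_invertible D" shows "\<exists>c>0. c *\<^sub>R 1 \<le> D"
proof -
  define E where "E = op_inverse D"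
  define N where "N = norm D + 1"
  define M where "M = norm E + 1"
  have N: "0 < N" "norm D \<le> N" by (auto simp: N_def add_nonneg_pos)
  have M: "0 < M" "norm E \<le> M" by (auto simp: M_def add_nonneg_pos)
  have sa: "selfadjoint D" using assms(1) by (rule selfadjoint_nonneg)
  have DN: "D \<le> N *\<^sub>R 1"
    using le_norm[OF sa] scaleR_one_mono[OF N(2)] by (rule order_trans)
  have "(1 / (M\<^sup>2 * N)) * inner x x \<le> inner x (app D x)" for x
  proof -
    have "x = app E (app D x)"
      using op_inverse_works(1)[OF assms(2)] by (metis E_def app_mult app_one)
    then have "norm x \<le> norm E * norm (app D x)" by (metis norm_app_le)
    also have "\<dots> \<le> M * norm (app D x)" using M by (simp add: mult_right_mono)
    finally have "inner x x \<le> M\<^sup>2 * (norm (app D x))\<^sup>2"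
      by (metis dot_square_norm norm_ge_zero power_mono power_mult_distrib)
    also have "\<dots> \<le> M\<^sup>2 * (N * inner x (app D x))"
      by (intro mult_left_mono norm_app_square_le assms DN N) simp
    finally show ?thesis using M N by (simp add: field_simps)
  qed
  then have "(1 / (M\<^sup>2 * N)) *\<^sub>R 1 \<le> D"
    by (intro leI_inner sa) (auto intro: selfadjoint_scaleR)
  moreover have "0 < 1 / (M\<^sup>2 * N)" using M N by simp
  ultimately show ?thesis by blast
qed

lemma posdef_iff: "posdef D \<longleftrightarrow> (\<exists>c>0. c *\<^sub>R 1 \<le> D)"
  for D :: "'a::nonzero_chilbert_space operator"
proof
  assume "\<exists>c>0. c *\<^sub>R 1 \<le> D"
  then obtain c where c: "c > 0" "c *\<^sub>R 1 \<le> D" by blast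
  have "0 \<le> c *\<^sub>R (1 :: 'a operator)" using c by (simp add: scaleR_nonneg_nonneg)
  with c show "posdef D" unfolding posdef_def
    by (auto intro: op_invertible_of_lower_bound)
qed (auto simp: posdef_def intro: lower_bound_of_op_invertible)

abbreviation real_spectrum :: "'a::chilbert_space operator \<Rightarrow> real set"
  where "real_spectrum T \<equiv> {x. complex_of_real x \<in> spectrum T}"

lemma real_spectrum_iff: "x \<in> real_spectrum T \<longleftrightarrow> \<not> op_invertible (T - x *\<^sub>R 1)"
  by (simp add: spectrum_def scaleR_scaleC)

text \<open>With \<open>c = a + \<i>b\<close>, the product of the commuting operators \<open>T - c\<close> and \<open>T - cnj c\<close> is
  \<open>(T - a)\<^sup>2 + b\<^sup>2\<close>, which is bounded below when \<open>b \<noteq> 0\<close>.\<close>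

lemma spectrum_real:
  fixes T :: "'a::nonzero_chilbert_space operator"
  assumes "selfadjoint T" "c \<in> spectrum T" shows "Im c = 0"
proof (rule ccontr)
  assume b: "Im c \<noteq> 0"
  define S where "S = T - Re c *\<^sub>R 1"
  define I where "I = (\<i> * Im c) *\<^sub>C (1 :: 'a operator)"
  have sa: "selfadjoint S" unfolding S_def
    by (intro selfadjoint_diff selfadjoint_scaleR assms) simp
  have c: "T - c *\<^sub>C 1 = S - I"
    unfolding S_def I_def scaleR_scaleC
    by (rule operator_eqI) (simp add: diff_diff_eq scaleC_add_left[symmetric] complex_eq[symmetric])
  have II: "I * I = - ((Im c)\<^sup>2 *\<^sub>R 1)"
  proof (rule operator_eqI)
    fix x
    have "app (I * I) x = (- of_real ((Im c)\<^sup>2)) *\<^sub>C x"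
      by (simp add: I_def power2_eq_square algebra_simps)
    also have "\<dots> = (- ((Im c)\<^sup>2)) *\<^sub>R x" by (simp only: scaleR_scaleC of_real_minus)
    finally show "app (I * I) x = app (- ((Im c)\<^sup>2 *\<^sub>R 1)) x"
      by (simp flip: scaleR_minus_left)
  qed
  have SI: "S * I = I * S" by (simp add: I_def mult_scaleC_left mult_scaleC_right)
  have prod: "(S - I) * (S + I) = S * 1 * S + (Im c)\<^sup>2 *\<^sub>R 1"
    using SI II by (simp add: algebra_simps)
  have "S * 0 * S \<le> S * 1 * S" by (intro conj_mono sa) simp
  then have "(Im c)\<^sup>2 *\<^sub>R 1 \<le> (S - I) * (S + I)" by (simp add: prod)
  then have "op_invertible ((S - I) * (S + I))"
    using b by (auto intro: op_invertible_of_lower_bound)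
  moreover have "(S - I) * (S + I) = (S + I) * (S - I)"
    using SI by (simp add: algebra_simps)
  ultimately have "op_invertible (S - I)" by (rule op_invertible_commute_factor)
  then show False using assms(2) by (simp add: spectrum_def c)
qed

lemma real_spectrum_ge:
  fixes T :: "'a::nonzero_chilbert_space operator"
  assumes "a *\<^sub>R 1 \<le> T" "x \<in> real_spectrum T" shows "a \<le> x"
proof (rule ccontr)
  assume "\<not> a \<le> x"
  moreover from assms(1) have "(a - x) *\<^sub>R 1 \<le> T - x *\<^sub>R 1"
    by (simp add: scaleR_diff_left)
  ultimately have "op_invertible (T - x *\<^sub>R 1)"
    by (intro op_invertible_of_lower_bound) auto
  with assms(2) show False by (simp add: real_spectrum_iff del: mem_Collect_eq)
qed

lemma real_spectrum_le:
  fixes T :: "'a::nonzero_chilbert_space operator"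
  assumes "T \<le> b *\<^sub>R 1" "x \<in> real_spectrum T" shows "x \<le> b"
proof (rule ccontr)
  assume "\<not> x \<le> b"
  moreover from assms(1) have "(x - b) *\<^sub>R 1 \<le> x *\<^sub>R 1 - T"
    by (simp add: scaleR_diff_left)
  ultimately have "op_invertible ((-1) *\<^sub>R (x *\<^sub>R 1 - T))"
    by (intro op_invertible_scaleR op_invertible_of_lower_bound) auto
  with assms(2) show False by (simp add: real_spectrum_iff del: mem_Collect_eq)
qed

lemma scaleR_one_le_imp_le:
  "a *\<^sub>R (1::'a::nonzero_chilbert_space operator) \<le> b *\<^sub>R 1 \<Longrightarrow> a \<le> b"
proof -
  assume *: "a *\<^sub>R (1::'a operator) \<le> b *\<^sub>R 1"
  obtain x :: 'a where "x \<noteq> 0" using ex_nonzero by blast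
  then show "a \<le> b" using leD_inner[OF *, of x] by simp
qed

text \<open>The bottom of the numerical range lies in the spectrum: if \<open>T - m\<close> were invertible, it would
  be bounded below, and \<open>m\<close> could be increased.\<close>

lemma real_spectrum_bottom:
  fixes T :: "'a::nonzero_chilbert_space operator"
  assumes "selfadjoint T" shows "\<exists>m\<in>real_spectrum T. m *\<^sub>R 1 \<le> T"
proof -
  define L where "L = {c. c *\<^sub>R 1 \<le> T}"
  define m where "m = Sup L"
  have L: "L \<noteq> {}" using minus_norm_le[OF assms] unfolding L_def by blast
  have bdd: "bdd_above L"
    using le_norm[OF assms] unfolding L_def
    by (intro bdd_aboveI[of _ "norm T"]) (metis mem_Collect_eq order_trans scaleR_one_le_imp_le)
  have m: "m *\<^sub>R 1 \<le> T"
  proof (rule leI_inner)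
    fix x
    show "inner x (app (m *\<^sub>R 1) x) \<le> inner x (app T x)"
    proof (cases "x = 0")
      case False
      have "m \<le> inner x (app T x) / inner x x"
        unfolding m_def using False
        by (intro cSup_least L) (auto simp: L_def le_divide_eq dest!: leD_inner[of _ _ x])
      then show ?thesis using False by (simp add: field_simps)
    qed simp
  qed (use assms in \<open>auto intro: selfadjoint_scaleR\<close>)
  have "\<not> op_invertible (T - m *\<^sub>R 1)"
  proof
    assume "op_invertible (T - m *\<^sub>R 1)"
    then obtain c where c: "c > 0" "c *\<^sub>R 1 \<le> T - m *\<^sub>R 1"
      using lower_bound_of_op_invertible m by (metis diff_ge_0_iff_ge)
    then have "m + c \<in> L" by (simp add: L_def scaleR_add_left le_diff_eq add.commute)
    then have "m + c \<le> m" unfolding m_def by (intro cSup_upper bdd)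
    with c show False by simp
  qed
  with m show ?thesis using real_spectrum_iff by blast
qed

section \<open>Polynomials of a self-adjoint operator\<close>

lemma scaleC_zero_left [simp]: "0 *\<^sub>C x = (0::'a::complex_vector)"
  by (metis of_real_0 scaleR_scaleC scaleR_zero_left)

definition cpoly_op :: "complex poly \<Rightarrow> 'a::chilbert_space operator \<Rightarrow> 'a operator"
  where "cpoly_op p T = fold_coeffs (\<lambda>a S. a *\<^sub>C 1 + T * S) p 0"

lemma cpoly_op_0 [simp]: "cpoly_op 0 T = 0"
  by (simp add: cpoly_op_def)

lemma cpoly_op_pCons [simp]: "cpoly_op (pCons a p) T = a *\<^sub>C 1 + T * cpoly_op p T"
  by (cases "a = 0 \<and> p = 0") (auto simp: cpoly_op_def)

lemma cpoly_op_add: "cpoly_op (p + q) T = cpoly_op p T + cpoly_op q T"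
proof (induction p arbitrary: q)
  case (pCons a p)
  then show ?case by (cases q) (simp add: scaleC_add_left algebra_simps)
qed simp

lemma cpoly_op_smult: "cpoly_op (smult c p) T = c *\<^sub>C cpoly_op p T"
proof (induction p)
  case 0
  show ?case by (auto intro: operator_eqI simp: bounded_linear.linear[OF bounded_linear_scaleC, THEN linear_0])
qed (simp add: scaleC_add_right mult_scaleC_right)

lemma cpoly_op_root_factor:
  "cpoly_op ([:- z, 1:] * q) T = (T - z *\<^sub>C 1) * cpoly_op q T"
proof -
  have "[:- z, 1:] * q = smult (- z) q + pCons 0 q" by simp
  moreover have "(- z) *\<^sub>C S = - (z *\<^sub>C S)" for S :: "'a operator"
    by (metis add_eq_0_iff scaleC_add_left scaleC_zero_left add.commute)
  ultimately show ?thesis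
    by (simp only: cpoly_op_add cpoly_op_smult cpoly_op_pCons)
      (simp add: algebra_simps mult_scaleC_left)
qed

text \<open>Over the complex numbers the polynomial splits into linear factors, so its value at \<open>T\<close> is a
  product of operators \<open>T - z\<close>.\<close>

lemma op_invertible_cpoly_op:
  assumes "p \<noteq> 0" "\<And>z. poly p z = 0 \<Longrightarrow> op_invertible (T - z *\<^sub>C 1)"
  shows "op_invertible (cpoly_op p T)"
  using assms
proof (induction "degree p" arbitrary: p rule: less_induct)
  case less
  show ?case
  proof (cases "degree p = 0")
    case True
    then obtain a where a: "p = [:a:]" "a \<noteq> 0"
      using less.prems(1) by (metis degree_eq_zeroE pCons_0_0)
    then show ?thesis
      by (intro op_invertibleI[of "(1/a) *\<^sub>C 1"]) (auto simp: mult_scaleC_left)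
  next
    case False
    then obtain z where z: "poly p z = 0"
      using fundamental_theorem_of_algebra constant_degree by metis
    then obtain q where q: "p = [:- z, 1:] * q"
      by (auto simp: poly_eq_0_iff_dvd dvd_def)
    with less.prems(1) have "q \<noteq> 0" by auto
    then have "degree p = Suc (degree q)" unfolding q by (subst degree_mult_eq) auto
    then have "op_invertible (cpoly_op q T)"
      using \<open>q \<noteq> 0\<close> less.prems(2) by (intro less.hyps) (auto simp: q)
    then show ?thesis
      unfolding q cpoly_op_root_factor using less.prems(2)[OF z] by (intro op_invertible_mult)
  qed
qed

lemma poly_op_alt:
  "degree p \<le> N \<Longrightarrow> poly_op p T = (\<Sum>i\<le>N. coeff p i *\<^sub>R T ^ i)"
  unfolding poly_op_def by (intro sum.mono_neutral_left) (auto simp: coeff_eq_0)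

lemma poly_op_0 [simp]: "poly_op 0 T = 0"
  by (simp add: poly_op_def)

lemma poly_op_pCons [simp]: "poly_op (pCons a p) T = a *\<^sub>R 1 + T * poly_op p T"
proof -
  have "poly_op (pCons a p) T = (\<Sum>i\<le>Suc (degree p). coeff (pCons a p) i *\<^sub>R T ^ i)"
    by (rule poly_op_alt) (rule degree_pCons_le)
  also have "\<dots> = a *\<^sub>R 1 + T * poly_op p T"
    unfolding sum.atMost_Suc_shift by (simp add: poly_op_def sum_distrib_left)
  finally show ?thesis .
qed

lemma cpoly_op_of_real: "cpoly_op (map_poly of_real p) T = poly_op p T"
  by (induction p) (simp_all add: map_poly_pCons scaleR_scaleC)

lemma poly_map_poly_of_real: "poly (map_poly of_real p) (of_real x :: complex) = of_real (poly p x)"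
  by (induction p) (simp_all add: map_poly_pCons)

lemma poly_op_add: "poly_op (p + q) T = poly_op p T + poly_op q T"
proof (induction p arbitrary: q)
  case (pCons a p)
  then show ?case by (cases q) (simp add: scaleR_add_left algebra_simps)
qed simp

lemma poly_op_smult: "poly_op (smult c p) T = c *\<^sub>R poly_op p T"
  by (induction p) (simp_all add: scaleR_add_right)

lemma poly_op_diff: "poly_op (p - q) T = poly_op p T - poly_op q T"
  using poly_op_add[of "p - q" q T] by simp

lemma poly_op_mult: "poly_op (p * q) T = poly_op p T * poly_op q T"
  by (induction p) (simp_all add: poly_op_add poly_op_smult algebra_simps)

lemma poly_op_intertwine: "S * T = U * S \<Longrightarrow> S * poly_op p T = poly_op p U * S"
proof (induction p)
  case (pCons a p)
  have "S * (T * poly_op p T) = U * poly_op p U * S"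
    using pCons by (metis mult.assoc)
  then show ?case by (simp add: algebra_simps)
qed simp

lemma selfadjoint_poly_op: "selfadjoint T \<Longrightarrow> selfadjoint (poly_op p T)"
proof (induction p)
  case (pCons a p)
  then show ?case
    using poly_op_intertwine[of T T T p]
    by (simp add: selfadjoint_add selfadjoint_scaleR selfadjoint_mult_commute)
qed simp

text \<open>If \<open>p(T) - m\<close> is not invertible, then neither is \<open>T - z\<close> for some complex root \<open>z\<close> of \<open>p - m\<close>,
  and \<open>z\<close> is real because \<open>T\<close> is self-adjoint.\<close>

lemma real_spectrum_poly_op:
  fixes T :: "'a::nonzero_chilbert_space operator"
  assumes "selfadjoint T" "m \<in> real_spectrum (poly_op p T)"
  shows "\<exists>x\<in>real_spectrum T. poly p x = m"
proof -
  define q where "q = p - [:m:]"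
  have ninv: "\<not> op_invertible (cpoly_op (map_poly of_real q) T)"
    using assms(2) real_spectrum_iff[of m "poly_op p T"]
    by (simp add: cpoly_op_of_real q_def poly_op_diff)
  show ?thesis
  proof (cases "q = 0")
    case True
    then show ?thesis using real_spectrum_bottom[OF assms(1)] by (auto simp: q_def)
  next
    case False
    then have "map_poly of_real q \<noteq> (0 :: complex poly)"
      by (metis map_poly_eq_0_iff of_real_eq_0_iff)
    then obtain z where z: "poly (map_poly of_real q) z = 0" "\<not> op_invertible (T - z *\<^sub>C 1)"
      using ninv op_invertible_cpoly_op by blast
    then have zs: "z \<in> spectrum T" by (simp add: spectrum_def)
    then have zr: "z = of_real (Re z)"
      using spectrum_real[OF assms(1)] by (simp add: complex_eq_iff)
    then have "poly (map_poly of_real q) (of_real (Re z) :: complex) = 0" using z(1) by simp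
    then have "complex_of_real (poly q (Re z)) = 0"
      by (simp add: poly_map_poly_of_real)
    then have "poly p (Re z) = m" by (simp add: q_def)
    with zs zr show ?thesis by (intro bexI[of _ "Re z"]) auto
  qed
qed

text \<open>The bottom of the numerical range of \<open>p(T)\<close> is a spectral value of \<open>p(T)\<close>, hence a value of \<open>p\<close>
  on the real spectrum of \<open>T\<close>.\<close>

lemma poly_op_nonneg:
  fixes T :: "'a::nonzero_chilbert_space operator"
  assumes "selfadjoint T" "\<And>x. x \<in> real_spectrum T \<Longrightarrow> 0 \<le> poly p x"
  shows "0 \<le> poly_op p T"
proof -
  obtain m where m: "m \<in> real_spectrum (poly_op p T)" "m *\<^sub>R 1 \<le> poly_op p T"
    using real_spectrum_bottom selfadjoint_poly_op[OF assms(1)] by blast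
  then have "0 \<le> m" using real_spectrum_poly_op[OF assms(1)] assms(2) by blast
  then have "0 \<le> m *\<^sub>R (1 :: 'a operator)" by (simp add: scaleR_nonneg_nonneg)
  with m(2) show ?thesis by order
qed

lemma norm_poly_op_le:
  fixes T :: "'a::nonzero_chilbert_space operator"
  assumes "selfadjoint T" "\<And>x. x \<in> real_spectrum T \<Longrightarrow> \<bar>poly p x\<bar> \<le> c" "0 < c"
  shows "norm (poly_op p T) \<le> c"
proof (rule norm_le_of_bounds)
  have "0 \<le> poly_op (p + [:c:]) T" "0 \<le> poly_op ([:c:] - p) T"
    by (rule poly_op_nonneg[OF assms(1)]; use assms(2) in fastforce)+
  then show "(- c) *\<^sub>R 1 \<le> poly_op p T" "poly_op p T \<le> c *\<^sub>R 1"
    by (simp_all add: poly_op_add poly_op_diff le_diff_eq add.commute flip: diff_le_eq)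
qed (rule assms(3))

section \<open>Continuous functional calculus\<close>

text \<open>The calculus is developed for functions on an interval \<open>[a, b]\<close> with \<open>a \<le> T \<le> b\<close> instead of
  the spectrum: there the Weierstrass theorem supplies the polynomials, and one interval can serve
  two operators at once.\<close>

abbreviation op_in :: "real \<Rightarrow> real \<Rightarrow> 'a::chilbert_space operator \<Rightarrow> bool"
  where "op_in a b T \<equiv> a *\<^sub>R 1 \<le> T \<and> T \<le> b *\<^sub>R 1"

lemma op_in_selfadjoint: "op_in a b T \<Longrightarrow> selfadjoint T"
  using selfadjoint_le_iff by (metis selfadjoint_one selfadjoint_scaleR)

lemma real_spectrum_subset:
  fixes T :: "'a::nonzero_chilbert_space operator"
  shows "op_in a b T \<Longrightarrow> real_spectrum T \<subseteq> {a..b}"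
  using real_spectrum_ge[of a T] real_spectrum_le[of T b] by auto

lemma op_in_le:
  fixes T :: "'a::nonzero_chilbert_space operator"
  shows "op_in a b T \<Longrightarrow> a \<le> b"
  using order_trans scaleR_one_le_imp_le by metis

lemma poly_op_diff_small:
  fixes T :: "'a::nonzero_chilbert_space operator"
  assumes T: "selfadjoint T"
    and p: "uniform_limit (real_spectrum T) (\<lambda>n x. poly (p n) x) f sequentially"
    and q: "uniform_limit (real_spectrum T) (\<lambda>n x. poly (q n) x) f sequentially"
    and "0 < e"
  shows "\<exists>N. \<forall>m\<ge>N. \<forall>n\<ge>N. norm (poly_op (p m) T - poly_op (q n) T) < e"
proof -
  have "\<forall>\<^sub>F n in sequentially. (\<forall>x\<in>real_spectrum T. dist (poly (p n) x) (f x) < e/4)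
      \<and> (\<forall>x\<in>real_spectrum T. dist (poly (q n) x) (f x) < e/4)"
    using \<open>0 < e\<close> by (intro eventually_conj uniform_limitD[OF p] uniform_limitD[OF q]) auto
  then obtain N where N: "\<And>n x. n \<ge> N \<Longrightarrow> x \<in> real_spectrum T
      \<Longrightarrow> dist (poly (p n) x) (f x) < e/4 \<and> dist (poly (q n) x) (f x) < e/4"
    unfolding eventually_sequentially by blast
  have "norm (poly_op (p m) T - poly_op (q n) T) < e" if "m \<ge> N" "n \<ge> N" for m n
  proof -
    have "norm (poly_op (p m - q n) T) \<le> e/2"
    proof (rule norm_poly_op_le[OF T])
      fix x assume x: "x \<in> real_spectrum T"
      show "\<bar>poly (p m - q n) x\<bar> \<le> e/2"
        using N[OF that(1) x, THEN conjunct1] N[OF that(2) x, THEN conjunct2]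
        unfolding dist_real_def poly_diff by linarith
    qed (use \<open>0 < e\<close> in simp)
    then show ?thesis using \<open>0 < e\<close> by (simp add: poly_op_diff)
  qed
  then show ?thesis by blast
qed

text \<open>The limit defining the functional calculus does not depend on the approximating polynomials,
  because two such sequences differ at \<open>T\<close> by a null sequence.\<close>

lemma cfc_eqI:
  fixes T :: "'a::nonzero_chilbert_space operator"
  assumes T: "selfadjoint T"
    and p: "uniform_limit (real_spectrum T) (\<lambda>n x. poly (p n) x) f sequentially"
    and S: "(\<lambda>n. poly_op (p n) T) \<longlonglongrightarrow> S"
  shows "cfc f T = S"
  unfolding cfc_def
proof (rule the_equality)
  fix R assume "\<exists>q. uniform_limit (real_spectrum T) (\<lambda>n x. poly (q n) x) f sequentially
                  \<and> (\<lambda>n. poly_op (q n) T) \<longlonglongrightarrow> R"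
  then obtain q where q: "uniform_limit (real_spectrum T) (\<lambda>n x. poly (q n) x) f sequentially"
    and R: "(\<lambda>n. poly_op (q n) T) \<longlonglongrightarrow> R" by blast
  have "(\<lambda>n. poly_op (q n) T - poly_op (p n) T) \<longlonglongrightarrow> 0"
    unfolding LIMSEQ_iff using poly_op_diff_small[OF T q p] by (simp) (metis)
  moreover have "(\<lambda>n. poly_op (q n) T - poly_op (p n) T) \<longlonglongrightarrow> R - S"
    by (intro tendsto_diff R S)
  ultimately have "R - S = 0" by (rule LIMSEQ_unique[symmetric])
  then show "R = S" by simp
qed (use p S in blast)

lemma cfc_tendsto:
  fixes T :: "'a::nonzero_chilbert_space operator"
  assumes T: "op_in a b T" and p: "uniform_limit {a..b} (\<lambda>n x. poly (p n) x) f sequentially"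
  shows "(\<lambda>n. poly_op (p n) T) \<longlonglongrightarrow> cfc f T"
proof -
  note sa = op_in_selfadjoint[OF T]
  have p': "uniform_limit (real_spectrum T) (\<lambda>n x. poly (p n) x) f sequentially"
    using p real_spectrum_subset[OF T] by (rule uniform_limit_on_subset)
  have "Cauchy (\<lambda>n. poly_op (p n) T)"
    unfolding Cauchy_def dist_norm using poly_op_diff_small[OF sa p' p'] by blast
  then obtain S where S: "(\<lambda>n. poly_op (p n) T) \<longlonglongrightarrow> S"
    by (meson Cauchy_convergent convergent_def)
  with cfc_eqI[OF sa p' S] show ?thesis by simp
qed

lemma poly_approx:
  fixes f :: "real \<Rightarrow> real"
  assumes "continuous_on {a..b} f"
  obtains p where "uniform_limit {a..b} (\<lambda>n x. poly (p n) x) f sequentially"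
proof -
  have "\<exists>p. \<forall>x\<in>{a..b}. \<bar>f x - poly p x\<bar> < inverse (real (Suc n))" for n
  proof -
    obtain g where g: "real_polynomial_function g"
      "\<And>x. x \<in> {a..b} \<Longrightarrow> \<bar>f x - g x\<bar> < inverse (real (Suc n))"
      using Stone_Weierstrass_real_polynomial_function[OF compact_Icc assms,
          of "inverse (real (Suc n))"] by auto
    obtain c k where "g = (\<lambda>x. \<Sum>i\<le>k. c i * x ^ i)"
      using g(1) by (auto simp: real_polynomial_function_iff_sum)
    then have "g = poly (\<Sum>i\<le>k. monom (c i) i)" by (simp add: poly_sum poly_monom fun_eq_iff)
    with g(2) show ?thesis by blast
  qed
  then obtain p where p: "\<And>n x. x \<in> {a..b} \<Longrightarrow> \<bar>f x - poly (p n) x\<bar> < inverse (real (Suc n))"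
    by metis
  have "uniform_limit {a..b} (\<lambda>n x. poly (p n) x) f sequentially"
  proof (rule uniform_limitI)
    fix e :: real assume "e > 0"
    then obtain N where N: "inverse (real (Suc N)) < e" using reals_Archimedean by blast
    have "dist (poly (p n) x) (f x) < e" if "n \<ge> N" "x \<in> {a..b}" for n x
    proof -
      have "inverse (real (Suc n)) \<le> inverse (real (Suc N))"
        using that(1) by (intro le_imp_inverse_le) auto
      with p[OF that(2), of n] N show ?thesis unfolding dist_real_def by linarith
    qed
    then show "\<forall>\<^sub>F n in sequentially. \<forall>x\<in>{a..b}. dist (poly (p n) x) (f x) < e"
      unfolding eventually_sequentially by blast
  qed
  then show thesis by (rule that)
qed

lemma cfc_poly:
  fixes T :: "'a::nonzero_chilbert_space operator"
  shows "selfadjoint T \<Longrightarrow> cfc (poly p) T = poly_op p T"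
  by (rule cfc_eqI[where p = "\<lambda>_. p"]) (auto intro: uniform_limit_const)

lemma cfc_affine:
  fixes T :: "'a::nonzero_chilbert_space operator"
  assumes "selfadjoint T" shows "cfc (\<lambda>x. c + x * d) T = c *\<^sub>R 1 + d *\<^sub>R T"
proof -
  have "(\<lambda>x. c + x * d) = poly [:c, d:]" by (simp add: fun_eq_iff)
  then show ?thesis using cfc_poly[OF assms, of "[:c, d:]"] by simp
qed

lemma cfc_const:
  fixes T :: "'a::nonzero_chilbert_space operator"
  shows "selfadjoint T \<Longrightarrow> cfc (\<lambda>_. c) T = c *\<^sub>R 1"
  using cfc_affine[of T c 0] by simp

lemma cfc_id:
  fixes T :: "'a::nonzero_chilbert_space operator"
  shows "selfadjoint T \<Longrightarrow> cfc (\<lambda>x. x) T = T"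
  using cfc_affine[of T 0 1] by simp

lemma cfc_cong:
  fixes T :: "'a::nonzero_chilbert_space operator"
  assumes T: "op_in a b T" and "continuous_on {a..b} f" "\<And>x. x \<in> {a..b} \<Longrightarrow> f x = g x"
  shows "cfc f T = cfc g T"
proof -
  obtain p where p: "uniform_limit {a..b} (\<lambda>n x. poly (p n) x) f sequentially"
    using poly_approx[OF assms(2)] .
  then have "uniform_limit {a..b} (\<lambda>n x. poly (p n) x) g sequentially"
    using assms(3) by (simp add: uniform_limit_iff)
  then show ?thesis using p by (metis LIMSEQ_unique T cfc_tendsto)
qed

lemma selfadjoint_cfc:
  fixes T :: "'a::nonzero_chilbert_space operator"
  assumes T: "op_in a b T" and "continuous_on {a..b} f"
  shows "selfadjoint (cfc f T)"
proof -
  obtain p where p: "uniform_limit {a..b} (\<lambda>n x. poly (p n) x) f sequentially"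
    using poly_approx[OF assms(2)] .
  show ?thesis
    by (rule selfadjoint_tendsto[OF cfc_tendsto[OF T p]])
      (intro selfadjoint_poly_op op_in_selfadjoint[OF T])
qed

lemma cfc_add:
  fixes T :: "'a::nonzero_chilbert_space operator"
  assumes T: "op_in a b T" and "continuous_on {a..b} f" "continuous_on {a..b} g"
  shows "cfc (\<lambda>x. f x + g x) T = cfc f T + cfc g T"
proof -
  obtain p q where p: "uniform_limit {a..b} (\<lambda>n x. poly (p n) x) f sequentially"
    and q: "uniform_limit {a..b} (\<lambda>n x. poly (q n) x) g sequentially"
    using poly_approx assms(2,3) by metis
  have "uniform_limit {a..b} (\<lambda>n x. poly (p n + q n) x) (\<lambda>x. f x + g x) sequentially"
    using uniform_limit_add[OF p q] by simp
  from cfc_tendsto[OF T this] show ?thesis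
    using tendsto_add[OF cfc_tendsto[OF T p] cfc_tendsto[OF T q]]
    by (simp add: poly_op_add LIMSEQ_unique)
qed

lemma cfc_mult:
  fixes T :: "'a::nonzero_chilbert_space operator"
  assumes T: "op_in a b T" and fg: "continuous_on {a..b} f" "continuous_on {a..b} g"
  shows "cfc (\<lambda>x. f x * g x) T = cfc f T * cfc g T"
proof -
  obtain p q where p: "uniform_limit {a..b} (\<lambda>n x. poly (p n) x) f sequentially"
    and q: "uniform_limit {a..b} (\<lambda>n x. poly (q n) x) g sequentially"
    using poly_approx fg by metis
  have "bounded (f ` {a..b})" "bounded (g ` {a..b})"
    using fg by (auto intro!: compact_imp_bounded compact_continuous_image)
  then have "uniform_limit {a..b} (\<lambda>n x. poly (p n * q n) x) (\<lambda>x. f x * g x) sequentially"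
    using uniform_lim_mult[OF p q] by simp
  from cfc_tendsto[OF T this] show ?thesis
    using tendsto_mult[OF cfc_tendsto[OF T p] cfc_tendsto[OF T q]]
    by (simp add: poly_op_mult LIMSEQ_unique)
qed

text \<open>If \<open>S\<close> is the value of \<open>sqrt f\<close> at \<open>T\<close>, then \<open>f(T) = S\<^sup>2 = S 1 S \<ge> 0\<close>.\<close>

lemma cfc_nonneg:
  fixes T :: "'a::nonzero_chilbert_space operator"
  assumes T: "op_in a b T" and f: "continuous_on {a..b} f" and nn: "\<And>x. x \<in> {a..b} \<Longrightarrow> 0 \<le> f x"
  shows "0 \<le> cfc f T"
proof -
  define S where "S = cfc (\<lambda>x. sqrt (f x)) T"
  have c: "continuous_on {a..b} (\<lambda>x. sqrt (f x))" using f by (intro continuous_intros)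
  have "cfc f T = cfc (\<lambda>x. sqrt (f x) * sqrt (f x)) T"
    using nn by (intro cfc_cong[OF T f]) auto
  also have "\<dots> = S * S" unfolding S_def by (rule cfc_mult[OF T c c])
  finally have "cfc f T = S * 1 * S" by simp
  moreover have "S * 0 * S \<le> S * 1 * S"
    unfolding S_def by (intro conj_mono selfadjoint_cfc[OF T c]) simp
  ultimately show ?thesis by simp
qed

lemma cfc_mono:
  fixes T :: "'a::nonzero_chilbert_space operator"
  assumes T: "op_in a b T" and fg: "continuous_on {a..b} f" "continuous_on {a..b} g"
    and le: "\<And>x. x \<in> {a..b} \<Longrightarrow> f x \<le> g x"
  shows "cfc f T \<le> cfc g T"
proof -
  have c: "continuous_on {a..b} (\<lambda>x. g x - f x)" using fg by (intro continuous_intros)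
  have "0 \<le> cfc (\<lambda>x. g x - f x) T" using le by (intro cfc_nonneg[OF T c]) simp
  also have "\<dots> = cfc g T - cfc f T"
    using cfc_add[OF T fg(1) c] by simp
  finally show ?thesis by simp
qed

lemma op_in_cfc:
  fixes T :: "'a::nonzero_chilbert_space operator"
  assumes T: "op_in a b T" and f: "continuous_on {a..b} f"
    and le: "\<And>x. x \<in> {a..b} \<Longrightarrow> f x \<in> {c..d}"
  shows "op_in c d (cfc f T)"
  using cfc_mono[OF T continuous_on_const f, of c] cfc_mono[OF T f continuous_on_const, of d] le
  by (auto simp: cfc_const[OF op_in_selfadjoint[OF T]])

lemma cfc_uniform_limit:
  fixes T :: "'a::nonzero_chilbert_space operator"
  assumes T: "op_in a b T" and F: "\<And>n. continuous_on {a..b} (F n)"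
    and lim: "uniform_limit {a..b} F f sequentially"
  shows "(\<lambda>n. cfc (F n) T) \<longlonglongrightarrow> cfc f T"
proof (rule metric_LIMSEQ_I)
  fix e :: real assume e: "e > 0"
  have f: "continuous_on {a..b} f"
    by (rule uniform_limit_theorem[OF _ lim]) (simp_all add: F)
  obtain N where N: "\<And>n x. n \<ge> N \<Longrightarrow> x \<in> {a..b} \<Longrightarrow> dist (F n x) (f x) < e/2"
    using uniform_limitD[OF lim half_gt_zero[OF e]] unfolding eventually_sequentially by blast
  have "dist (cfc (F n) T) (cfc f T) < e" if "n \<ge> N" for n
  proof -
    have c: "continuous_on {a..b} (\<lambda>x. F n x - f x)" by (intro continuous_intros F f)
    have "op_in (- (e/2)) (e/2) (cfc (\<lambda>x. F n x - f x) T)"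
    proof (rule op_in_cfc[OF T c])
      fix x assume "x \<in> {a..b}"
      from N[OF that this] show "F n x - f x \<in> {- (e/2)..e/2}"
        unfolding dist_real_def atLeastAtMost_iff by linarith
    qed
    then have "norm (cfc (\<lambda>x. F n x - f x) T) \<le> e/2"
      using e by (intro norm_le_of_bounds) auto
    also have "cfc (\<lambda>x. F n x - f x) T = cfc (F n) T - cfc f T"
      using cfc_add[OF T f c] by simp
    finally show ?thesis using e by (simp add: dist_norm)
  qed
  then show "\<exists>N. \<forall>n\<ge>N. dist (cfc (F n) T) (cfc f T) < e" by blast
qed

lemma cfc_intertwine:
  fixes T U :: "'a::nonzero_chilbert_space operator"
  assumes T: "op_in a b T" and U: "op_in a b U" and f: "continuous_on {a..b} f"
    and ST: "S * T = U * S"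
  shows "S * cfc f T = cfc f U * S"
proof -
  obtain p where p: "uniform_limit {a..b} (\<lambda>n x. poly (p n) x) f sequentially"
    using poly_approx[OF f] .
  have "(\<lambda>n. S * poly_op (p n) T) \<longlonglongrightarrow> S * cfc f T"
    by (intro tendsto_mult tendsto_const cfc_tendsto[OF T p])
  moreover have "(\<lambda>n. S * poly_op (p n) T) \<longlonglongrightarrow> cfc f U * S"
    unfolding poly_op_intertwine[OF ST]
    by (intro tendsto_mult tendsto_const cfc_tendsto[OF U p])
  ultimately show ?thesis by (rule LIMSEQ_unique)
qed

lemma poly_op_cfc:
  fixes T :: "'a::nonzero_chilbert_space operator"
  assumes T: "op_in a b T" and g: "continuous_on {a..b} g"
  shows "poly_op p (cfc g T) = cfc (\<lambda>x. poly p (g x)) T"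
proof (induction p)
  case 0
  show ?case by (simp add: cfc_const[OF op_in_selfadjoint[OF T]])
next
  case (pCons c p)
  have "continuous_on {a..b} (\<lambda>x. poly p (g x))" using g by (intro continuous_intros)
  then show ?case
    using g pCons by (simp add: cfc_add[OF T] cfc_mult[OF T] continuous_on_mult
        cfc_const[OF op_in_selfadjoint[OF T]])
qed

lemma cfc_cfc:
  fixes T :: "'a::nonzero_chilbert_space operator"
  assumes T: "op_in a b T" and g: "continuous_on {a..b} g" and f: "continuous_on {c..d} f"
    and into: "\<And>x. x \<in> {a..b} \<Longrightarrow> g x \<in> {c..d}"
  shows "cfc f (cfc g T) = cfc (\<lambda>x. f (g x)) T"
proof -
  obtain p where p: "uniform_limit {c..d} (\<lambda>n x. poly (p n) x) f sequentially"
    using poly_approx[OF f] .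
  have "(\<lambda>n. poly_op (p n) (cfc g T)) \<longlonglongrightarrow> cfc f (cfc g T)"
    by (intro cfc_tendsto[OF _ p] op_in_cfc[OF T g] into)
  moreover have "(\<lambda>n. cfc (\<lambda>x. poly (p n) (g x)) T) \<longlonglongrightarrow> cfc (\<lambda>x. f (g x)) T"
  proof (rule cfc_uniform_limit[OF T])
    show "continuous_on {a..b} (\<lambda>x. poly (p n) (g x))" for n
      using g by (intro continuous_intros)
    show "uniform_limit {a..b} (\<lambda>n x. poly (p n) (g x)) (\<lambda>x. f (g x)) sequentially"
      using p into unfolding uniform_limit_iff by (fastforce elim: eventually_mono)
  qed
  ultimately show ?thesis by (simp add: poly_op_cfc[OF T g] LIMSEQ_unique)
qed

section \<open>Real powers of positive definite operators\<close>

lemma posdef_bounds: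
  fixes T :: "'a::nonzero_chilbert_space operator"
  assumes "posdef T" obtains a b where "0 < a" "op_in a b T"
proof -
  obtain a where "0 < a" "a *\<^sub>R 1 \<le> T" using assms posdef_iff by blast
  moreover have "T \<le> norm T *\<^sub>R 1"
    using assms by (intro le_norm selfadjoint_nonneg) (simp add: posdef_def)
  ultimately show thesis using that by blast
qed

lemma posdef_nonneg: "posdef T \<Longrightarrow> 0 \<le> T"
  by (simp add: posdef_def)

lemma posdef_selfadjoint: "posdef T \<Longrightarrow> selfadjoint T"
  by (simp add: posdef_def selfadjoint_nonneg)

lemma posdef_mono:
  fixes S T :: "'a::nonzero_chilbert_space operator"
  shows "posdef S \<Longrightarrow> S \<le> T \<Longrightarrow> posdef T"
  unfolding posdef_iff using order_trans by blast

lemma posdef_scaleR: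
  fixes S :: "'a::nonzero_chilbert_space operator"
  shows "posdef S \<Longrightarrow> 0 < c \<Longrightarrow> posdef (c *\<^sub>R S)"
  by (simp add: posdef_def scaleR_nonneg_nonneg op_invertible_scaleR)

lemma posdef_conj:
  fixes S :: "'a::nonzero_chilbert_space operator"
  assumes "posdef S" "posdef V" shows "posdef (V * S * V)"
  using conj_mono[OF posdef_selfadjoint[OF assms(2)] posdef_nonneg[OF assms(1)]] assms
  by (simp add: posdef_def op_invertible_mult)

lemma continuous_on_powr_const:
  "0 < (a::real) \<Longrightarrow> continuous_on {a..b} (\<lambda>x. x powr s)"
  by (intro continuous_intros) auto

lemma op_powr_0: "posdef T \<Longrightarrow> op_powr T 0 = 1"
  and op_powr_1: "posdef T \<Longrightarrow> op_powr T 1 = T"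
  for T :: "'a::nonzero_chilbert_space operator"
proof -
  assume T: "posdef T"
  then obtain a b where ab: "0 < a" "op_in a b T" using posdef_bounds by blast
  note sa = posdef_selfadjoint[OF T]
  have "op_powr T 0 = cfc (\<lambda>_. 1) T"
    unfolding op_powr_def using ab(1) by (intro cfc_cong[OF ab(2)] continuous_on_powr_const) auto
  then show "op_powr T 0 = 1" using cfc_const[OF sa, of 1] by simp
  have "op_powr T 1 = cfc (\<lambda>x. x) T"
    unfolding op_powr_def using ab(1) by (intro cfc_cong[OF ab(2)] continuous_on_powr_const) auto
  then show "op_powr T 1 = T" using cfc_id[OF sa] by simp
qed

lemma op_powr_add:
  fixes T :: "'a::nonzero_chilbert_space operator"
  assumes T: "posdef T" shows "op_powr T s * op_powr T r = op_powr T (s + r)"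
proof -
  obtain a b where ab: "0 < a" "op_in a b T" using T posdef_bounds by blast
  show ?thesis unfolding op_powr_def powr_add
    using ab(1) by (intro cfc_mult[OF ab(2), symmetric] continuous_on_powr_const)
qed

lemma op_powr_minus_cancel:
  fixes T :: "'a::nonzero_chilbert_space operator"
  assumes T: "posdef T"
  shows "op_powr T s * op_powr T (- s) = 1" "op_powr T (- s) * op_powr T s = 1"
  using op_powr_add[OF T] op_powr_0[OF T] by auto

lemma posdef_op_powr:
  fixes T :: "'a::nonzero_chilbert_space operator"
  assumes T: "posdef T" shows "posdef (op_powr T s)"
proof -
  obtain a b where ab: "0 < a" "op_in a b T" using T posdef_bounds by blast
  have "0 \<le> op_powr T s" unfolding op_powr_def
    using ab(1) by (intro cfc_nonneg[OF ab(2)] continuous_on_powr_const) auto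
  then show ?thesis
    using op_powr_minus_cancel[OF T] by (auto simp: posdef_def intro: op_invertibleI)
qed

lemma op_in_op_powr:
  fixes T :: "'a::nonzero_chilbert_space operator"
  assumes "0 < a" "op_in a b T" "0 \<le> s" shows "op_in (a powr s) (b powr s) (op_powr T s)"
  unfolding op_powr_def using assms(1,3)
  by (intro op_in_cfc[OF assms(2)] continuous_on_powr_const) (auto intro: powr_mono2)

lemma op_powr_powr:
  fixes T :: "'a::nonzero_chilbert_space operator"
  assumes T: "posdef T" shows "op_powr (op_powr T r) s = op_powr T (r * s)"
proof -
  obtain a b where ab: "0 < a" "op_in a b T" using T posdef_bounds by blast
  define c where "c = min (a powr r) (b powr r)"
  define d where "d = max (a powr r) (b powr r)"
  have "a \<le> b" using op_in_le ab(2) by blast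
  then have "0 < c" using ab(1) by (simp add: c_def)
  have "x powr r \<in> {c..d}" if "x \<in> {a..b}" for x
  proof (cases "0 \<le> r")
    case True
    then have "a powr r \<le> x powr r" "x powr r \<le> b powr r"
      using that ab(1) by (auto intro: powr_mono2)
    then show ?thesis by (auto simp: c_def d_def)
  next
    case False
    then have "a powr r \<ge> x powr r" "x powr r \<ge> b powr r"
      using that ab(1) by (auto intro: powr_mono2')
    then show ?thesis by (auto simp: c_def d_def)
  qed
  then show ?thesis
    unfolding op_powr_def powr_powr[symmetric]
    using ab(1) \<open>0 < c\<close> by (intro cfc_cfc[OF ab(2)] continuous_on_powr_const)
qed

lemma op_powr_inverse:
  fixes T :: "'a::nonzero_chilbert_space operator"
  assumes T: "posdef T" and "S * T = 1" shows "op_powr S s = op_powr T (- s)"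
proof -
  have "S = S * (op_powr T 1 * op_powr T (-1))" by (simp add: op_powr_minus_cancel[OF T])
  also have "\<dots> = op_powr T (-1)"
    using assms by (simp add: op_powr_1[OF T] mult.assoc[symmetric])
  finally show ?thesis by (simp add: op_powr_powr[OF T])
qed

lemma op_powr_scaleR:
  fixes T :: "'a::nonzero_chilbert_space operator"
  assumes T: "posdef T" and c: "0 < c"
  shows "op_powr (c *\<^sub>R T) s = c powr s *\<^sub>R op_powr T s"
proof -
  obtain a b where ab: "0 < a" "op_in a b T" using T posdef_bounds by blast
  note sa = posdef_selfadjoint[OF T]
  have "op_powr (c *\<^sub>R T) s = cfc (\<lambda>x. x powr s) (cfc (\<lambda>x. 0 + x * c) T)"
    by (simp add: op_powr_def cfc_affine[OF sa, of 0 c, simplified])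
  also have "\<dots> = cfc (\<lambda>x. (0 + x * c) powr s) T"
  proof (rule cfc_cfc[OF ab(2)])
    show "continuous_on {a * c..b * c} (\<lambda>x. x powr s)"
      using ab(1) c by (intro continuous_on_powr_const) simp
  qed (use ab(1) c in \<open>auto intro!: continuous_intros\<close>)
  also have "\<dots> = cfc (\<lambda>x. c powr s * x powr s) T"
    using ab(1) c by (intro cfc_cong[OF ab(2)] continuous_intros) (auto simp: powr_mult)
  also have "\<dots> = c powr s *\<^sub>R op_powr T s"
    using ab(1)
    by (simp add: cfc_mult[OF ab(2)] continuous_on_powr_const cfc_const[OF sa] op_powr_def)
  finally show ?thesis .
qed

lemma op_powr_intertwine:
  fixes T U :: "'a::nonzero_chilbert_space operator"
  assumes T: "posdef T" and U: "posdef U" and ST: "S * T = U * S"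
  shows "S * op_powr T s = op_powr U s * S"
proof -
  obtain a b where ab: "0 < a" "op_in a b T" using T posdef_bounds by blast
  obtain c d where cd: "0 < c" "op_in c d U" using U posdef_bounds by blast
  have "op_in (min a c) (max b d) T" "op_in (min a c) (max b d) U"
    using ab(2) cd(2) scaleR_one_mono[of "min a c"] scaleR_one_mono[of _ "max b d"]
    by (meson order_trans max.cobounded1 max.cobounded2 min.cobounded1 min.cobounded2)+
  then show ?thesis
    unfolding op_powr_def using ab(1) cd(1)
    by (intro cfc_intertwine[where a = "min a c" and b = "max b d", OF _ _ _ ST]
        continuous_on_powr_const) auto
qed

lemma op_powr_tendsto:
  fixes T :: "'a::nonzero_chilbert_space operator"
  assumes T: "posdef T" and s: "\<And>n. s n \<in> {0..1}" "s \<longlonglongrightarrow> r"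
  shows "(\<lambda>n. op_powr T (s n)) \<longlonglongrightarrow> op_powr T r"
proof -
  obtain a b where ab: "0 < a" "op_in a b T" using T posdef_bounds by blast
  have r: "r \<in> {0..1}" using closed_sequentially[OF closed_atLeastAtMost s] .
  have uc0: "uniformly_continuous_on ({0..1} \<times> {a..b}) (\<lambda>(s, x). x powr s)"
    unfolding case_prod_unfold using ab(1)
    by (intro compact_uniformly_continuous continuous_intros compact_Times compact_Icc) auto
  have uc: "\<exists>d>0. \<forall>s\<in>{0..1}. \<forall>x\<in>{a..b}. dist s r < d \<longrightarrow> dist (x powr s) (x powr r) < e"
    if "e > 0" for e
  proof -
    obtain d where d: "d > 0" "\<And>p p'. p \<in> {0..1} \<times> {a..b} \<Longrightarrow> p' \<in> {0..1} \<times> {a..b} \<Longrightarrow> dist p' p < d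
        \<Longrightarrow> dist (case p' of (s, x) \<Rightarrow> x powr s) (case p of (s, x) \<Rightarrow> x powr s) < e"
      using uc0 \<open>e > 0\<close> unfolding uniformly_continuous_on_def by metis
    have "dist (x powr s) (x powr r) < e" if "s \<in> {0..1}" "x \<in> {a..b}" "dist s r < d" for s x
      using d(2)[of "(r, x)" "(s, x)"] that r by (simp add: dist_Pair_Pair)
    with d(1) show ?thesis by blast
  qed
  have "uniform_limit {a..b} (\<lambda>n x. x powr s n) (\<lambda>x. x powr r) sequentially"
  proof (rule uniform_limitI)
    fix e :: real assume "e > 0"
    then obtain d where d: "d > 0"
      "\<And>s x. s \<in> {0..1} \<Longrightarrow> x \<in> {a..b} \<Longrightarrow> dist s r < d \<Longrightarrow> dist (x powr s) (x powr r) < e"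
      using uc by metis
    have "\<forall>\<^sub>F n in sequentially. dist (s n) r < d" using s(2) d(1) by (rule tendstoD)
    then show "\<forall>\<^sub>F n in sequentially. \<forall>x\<in>{a..b}. dist (x powr s n) (x powr r) < e"
      by eventually_elim (use d(2) s(1) in blast)
  qed
  then show ?thesis
    unfolding op_powr_def using ab(1)
    by (intro cfc_uniform_limit[OF ab(2)] continuous_on_powr_const)
qed

section \<open>The Loewner--Heinz inequality\<close>

lemma norm_le_norm_adjoint:
  assumes adj: "\<And>x y. inner (app U x) y = inner x (app V y)" shows "norm U \<le> norm V"
proof (rule op_norm_leI)
  fix x
  have "norm (app U x) * norm (app U x) = inner x (app V (app U x))"
    by (simp add: adj[symmetric] dot_square_norm power2_eq_square)
  also have "\<dots> \<le> norm x * norm (app V (app U x))" by (rule norm_cauchy_schwarz)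
  also have "\<dots> \<le> norm x * (norm V * norm (app U x))"
    by (intro mult_left_mono norm_app_le) simp
  finally have "norm (app U x) * norm (app U x) \<le> (norm V * norm x) * norm (app U x)"
    by (simp add: mult_ac)
  then show "norm (app U x) \<le> norm V * norm x"
    by (cases "app U x = 0") (auto simp: mult_le_cancel_right)
qed simp

lemma norm_square_selfadjoint:
  fixes S :: "'a::chilbert_space operator"
  assumes "selfadjoint S" shows "norm (S * S) = (norm S)\<^sup>2"
proof (rule antisym)
  show "norm (S * S) \<le> (norm S)\<^sup>2" by (simp add: power2_eq_square norm_mult_ineq)
  have "norm S \<le> sqrt (norm (S * S))"
  proof (rule op_norm_leI)
    fix x
    have "(norm (app S x))\<^sup>2 = inner x (app (S * S) x)"
      using selfadjointD[OF assms, of x "app S x"] by (simp add: dot_square_norm)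
    also have "\<dots> \<le> norm x * norm (app (S * S) x)" by (rule norm_cauchy_schwarz)
    also have "\<dots> \<le> norm x * (norm (S * S) * norm x)"
      by (intro mult_left_mono norm_app_le) simp
    also have "\<dots> = (sqrt (norm (S * S)) * norm x)\<^sup>2"
      by (simp add: power_mult_distrib power2_eq_square mult_ac)
    finally show "norm (app S x) \<le> sqrt (norm (S * S)) * norm x"
      by (rule power2_le_imp_le) simp
  qed simp
  then show "(norm S)\<^sup>2 \<le> norm (S * S)"
    using real_le_rsqrt real_sqrt_le_iff by (metis norm_ge_zero power_mono real_sqrt_pow2)
qed

text \<open>For a self-adjoint operator the powers \<open>P\<^bsup>2\<^sup>k\<^esup>\<close> have norm exactly \<open>\<parallel>P\<parallel>\<^bsup>2\<^sup>k\<^esup>\<close>.  They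
  stay bounded only if \<open>\<parallel>P\<parallel> \<le> 1\<close>.\<close>

lemma norm_le_one_of_power_bounded:
  fixes P :: "'a::chilbert_space operator"
  assumes sa: "selfadjoint P" and bd: "\<And>n. norm (P ^ n) \<le> C"
  shows "norm P \<le> 1"
proof (rule ccontr)
  assume "\<not> norm P \<le> 1"
  have "selfadjoint (P ^ (2 ^ k)) \<and> norm (P ^ (2 ^ k)) = norm P ^ (2 ^ k)" for k
  proof (induction k)
    case (Suc k)
    have "P ^ (2 ^ Suc k) = P ^ (2 ^ k) * P ^ (2 ^ k)" by (simp add: mult_2 power_add)
    with Suc show ?case
      by (simp add: selfadjoint_mult_commute norm_square_selfadjoint power_mult
          power2_eq_square power_add mult_2)
  qed (use sa in simp)
  then have "norm P ^ (2 ^ k) \<le> C" for k by (metis bd)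
  moreover obtain m where "C < norm P ^ m"
    using real_arch_pow[of "norm P" C] \<open>\<not> norm P \<le> 1\<close> by auto
  moreover have "norm P ^ m \<le> norm P ^ (2 ^ m)"
    using \<open>\<not> norm P \<le> 1\<close> less_exp[of m] by (intro power_increasing) linarith+
  ultimately show False by (metis not_le order_trans)
qed

text \<open>Pedersen's argument.  The inequalities at \<open>s\<close> and \<open>r\<close> say that \<open>A\<^bsup>s/2\<^esup>B\<^bsup>-s/2\<^esup>\<close> and
  \<open>B\<^bsup>-r/2\<^esup>A\<^bsup>r/2\<^esup>\<close> are contractions.  Their product \<open>Q\<close> is similar to the positive operator
  \<open>P = B\<^bsup>-q/2\<^esup>A\<^bsup>q\<^esup>B\<^bsup>-q/2\<^esup>\<close> with \<open>q = (s + r)/2\<close>, so the powers of \<open>P\<close> are bounded and \<open>P \<le> 1\<close>.\<close>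

lemma op_powr_mono_midpoint:
  fixes A B :: "'a::nonzero_chilbert_space operator"
  assumes A: "posdef A" and B: "posdef B"
    and s: "op_powr A s \<le> op_powr B s" and r: "op_powr A r \<le> op_powr B r"
  shows "op_powr A ((s + r)/2) \<le> op_powr B ((s + r)/2)"
proof -
  note adA = op_powr_add[OF A] and adB = op_powr_add[OF B]
  have saA: "selfadjoint (op_powr A u)" and saB: "selfadjoint (op_powr B u)" for u
    by (rule posdef_selfadjoint posdef_op_powr A B)+
  have contr: "norm (op_powr A (u/2) * op_powr B (- u/2)) \<le> 1"
    if le: "op_powr A u \<le> op_powr B u" for u
  proof (rule op_norm_leI)
    fix x
    define y where "y = app (op_powr B (- u/2)) x"
    have "(norm (app (op_powr A (u/2)) y))\<^sup>2 = inner y (app (op_powr A (u/2) * op_powr A (u/2)) y)"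
      unfolding app_mult selfadjointD[OF saA[of "u/2"], of y, symmetric]
      by (rule dot_square_norm[symmetric])
    also have "\<dots> \<le> inner y (app (op_powr B u) y)"
      using leD_inner[OF le] by (simp add: adA)
    also have "\<dots> = inner x (app (op_powr B (- u/2) * op_powr B u * op_powr B (- u/2)) x)"
      unfolding y_def app_mult selfadjointD[OF saB] by (rule refl)
    also have "\<dots> = (norm x)\<^sup>2" by (simp add: adB op_powr_0[OF B] dot_square_norm)
    finally have "norm (app (op_powr A (u/2)) y) \<le> norm x"
      by (rule power2_le_imp_le) simp
    then show "norm (app (op_powr A (u/2) * op_powr B (- u/2)) x) \<le> 1 * norm x"
      by (simp add: y_def)
  qed simp
  define q where "q = (s + r)/2"
  define P where "P = op_powr B (- q/2) * op_powr A q * op_powr B (- q/2)"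
  define Q where "Q = op_powr B (- r/2) * op_powr A q * op_powr B (- s/2)"
  define W where "W = op_powr B (r/2 - q/2)"
  define W' where "W' = op_powr B (q/2 - r/2)"
  have "norm (op_powr B (- r/2) * op_powr A (r/2)) \<le> norm (op_powr A (r/2) * op_powr B (- r/2))"
    by (rule norm_le_norm_adjoint) (simp only: app_mult selfadjointD[OF saA] selfadjointD[OF saB])
  also have "\<dots> \<le> 1" by (rule contr[OF r])
  finally have "norm ((op_powr B (- r/2) * op_powr A (r/2)) * (op_powr A (s/2) * op_powr B (- s/2))) \<le> 1 * 1"
    using contr[OF s] by (rule order_trans[OF norm_mult_ineq mult_mono]) simp_all
  also have "(op_powr B (- r/2) * op_powr A (r/2)) * (op_powr A (s/2) * op_powr B (- s/2)) = Q"
  proof -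
    have "op_powr A (r/2) * op_powr A (s/2) = op_powr A q"
      by (simp add: adA q_def add_divide_distrib add.commute)
    then show ?thesis by (metis Q_def mult.assoc)
  qed
  finally have Q1: "norm Q \<le> 1" by simp
  have WW: "W' * W = 1" by (simp add: W_def W'_def adB op_powr_0[OF B])
  have P: "P = W * Q * W'"
  proof -
    have "W * op_powr B (- r/2) = op_powr B (- q/2)" by (simp add: W_def adB)
    moreover have "- s/2 + (q/2 - r/2) = - q/2" by (simp add: q_def field_simps)
    then have "op_powr B (- s/2) * W' = op_powr B (- q/2)" by (simp only: W'_def adB)
    ultimately show ?thesis by (metis P_def Q_def mult.assoc)
  qed
  have Pn: "P ^ n = W * Q ^ n * W'" for n
  proof (induction n)
    case 0
    show ?case by (simp add: W_def W'_def adB op_powr_0[OF B])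
  next
    case (Suc n)
    have "P ^ Suc n = (W * Q * W') * (W * Q ^ n * W')"
      unfolding power_Suc Suc.IH by (simp only: P[symmetric])
    also have "\<dots> = W * Q * (W' * W) * Q ^ n * W'" by (simp only: mult.assoc)
    also have "\<dots> = W * Q ^ Suc n * W'" by (simp only: WW mult_1_right power_Suc mult.assoc)
    finally show ?case .
  qed
  have saP: "selfadjoint P" unfolding P_def by (intro selfadjoint_conj saA saB)
  have "norm (P ^ n) \<le> norm W * 1 * norm W'" for n
  proof -
    have "norm (Q ^ n) \<le> 1"
      using norm_power_ineq[of Q n] power_le_one[OF norm_ge_zero Q1, of n] by linarith
    then have "norm (W * Q ^ n) \<le> norm W * 1"
      by (intro order_trans[OF norm_mult_ineq mult_left_mono]) auto
    then show ?thesis unfolding Pn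
      by (intro order_trans[OF norm_mult_ineq mult_right_mono]) auto
  qed
  then have "norm P \<le> 1" by (rule norm_le_one_of_power_bounded[OF saP])
  then have "P \<le> 1 *\<^sub>R 1" by (intro order_trans[OF le_norm[OF saP] scaleR_one_mono])
  then have "P \<le> 1" by (simp only: scaleR_one)
  then have "op_powr B (q/2) * P * op_powr B (q/2) \<le> op_powr B (q/2) * 1 * op_powr B (q/2)"
    by (intro conj_mono saB)
  moreover have "op_powr B (q/2) * P * op_powr B (q/2) = op_powr A q"
    "op_powr B (q/2) * 1 * op_powr B (q/2) = op_powr B q"
  proof -
    have "op_powr B (q/2) * op_powr B (- q/2) = 1" "op_powr B (- q/2) * op_powr B (q/2) = 1"
      by (simp_all add: adB op_powr_0[OF B])
    then show "op_powr B (q/2) * P * op_powr B (q/2) = op_powr A q"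
      unfolding P_def by (metis mult.assoc mult_1 mult_1_right)
    show "op_powr B (q/2) * 1 * op_powr B (q/2) = op_powr B q" by (simp add: adB)
  qed
  ultimately show ?thesis unfolding q_def by (simp only:)
qed

text \<open>The exponents for which the inequality holds form a closed set containing \<open>0\<close>, \<open>1\<close> and all
  its midpoints.  A gap in it would have end points in the set, and hence a midpoint in the set.\<close>

theorem op_powr_mono:
  fixes A B :: "'a::nonzero_chilbert_space operator"
  assumes A: "posdef A" and B: "posdef B" and le: "A \<le> B" and t: "0 \<le> t" "t \<le> 1"
  shows "op_powr A t \<le> op_powr B t"
proof (rule ccontr)
  assume nt: "\<not> op_powr A t \<le> op_powr B t"
  define E where "E = {s\<in>{0..1}. op_powr A s \<le> op_powr B s}"
  have "closed E"
    unfolding closed_sequential_limits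
  proof (intro allI impI, elim conjE)
    fix s l assume s: "\<forall>n::nat. s n \<in> E" "s \<longlonglongrightarrow> l"
    then have s': "\<And>n. s n \<in> {0..1}" by (auto simp: E_def)
    have "op_powr A l \<le> op_powr B l"
      using s(1) by (intro op_tendsto_le[OF op_powr_tendsto[OF A s' s(2)] op_powr_tendsto[OF B s' s(2)]])
        (auto simp: E_def)
    then show "l \<in> E"
      using closed_sequentially[OF closed_atLeastAtMost s' s(2)] by (simp add: E_def)
  qed
  have E01: "0 \<in> E" "1 \<in> E"
    using le by (auto simp: E_def op_powr_0[OF A] op_powr_0[OF B] op_powr_1[OF A] op_powr_1[OF B])
  define a where "a = Sup (E \<inter> {..t})"
  define b where "b = Inf (E \<inter> {t..})"
  have "a \<in> E \<inter> {..t}" unfolding a_def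
    using E01(1) t(1) \<open>closed E\<close> by (intro closed_contains_Sup closed_Int) auto
  moreover have "b \<in> E \<inter> {t..}" unfolding b_def
    using E01(2) t(2) \<open>closed E\<close> by (intro closed_contains_Inf closed_Int) auto
  moreover have "t \<notin> E" using nt t by (simp add: E_def)
  ultimately have ab: "a \<in> E" "a < t" "b \<in> E" "t < b" by (auto simp: order_less_le)
  then have m: "(a + b)/2 \<in> E"
    using op_powr_mono_midpoint[OF A B, of a b] by (auto simp: E_def)
  show False
  proof (cases "(a + b)/2 \<le> t")
    case True
    then have "(a + b)/2 \<le> a"
      using m unfolding a_def by (intro cSup_upper) auto
    with ab show False by simp
  next
    case False
    then have "b \<le> (a + b)/2"
      using m unfolding b_def by (intro cInf_lower) auto
    with ab show False by simp
  qed
qed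

section \<open>Weighted geometric means\<close>

lemma posdef_geo_mean:
  fixes X A :: "'a::nonzero_chilbert_space operator"
  shows "posdef X \<Longrightarrow> posdef A \<Longrightarrow> posdef (geo_mean t X A)"
  unfolding geo_mean_def by (intro posdef_conj posdef_op_powr)

lemma op_powr_half_conj:
  fixes X :: "'a::nonzero_chilbert_space operator"
  assumes "posdef X"
  shows "op_powr X (1/2) * op_powr X (1/2) = X"
    and "op_powr X (1/2) * op_powr X (-1/2) = 1"
    and "op_powr X (-1/2) * op_powr X (1/2) = 1"
    and "op_powr X (-1/2) * X * op_powr X (-1/2) = 1"
proof -
  show *: "op_powr X (1/2) * op_powr X (1/2) = X"
    using op_powr_add[OF assms, of "1/2" "1/2"] by (simp add: op_powr_1[OF assms])
  show **: "op_powr X (1/2) * op_powr X (-1/2) = 1" "op_powr X (-1/2) * op_powr X (1/2) = 1"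
    using op_powr_minus_cancel[OF assms, of "1/2"] by simp_all
  have "op_powr X (-1/2) * (op_powr X (1/2) * op_powr X (1/2)) * op_powr X (-1/2)
      = (op_powr X (-1/2) * op_powr X (1/2)) * (op_powr X (1/2) * op_powr X (-1/2))"
    by (simp only: mult.assoc)
  then show "op_powr X (-1/2) * X * op_powr X (-1/2) = 1"
    by (simp only: * ** mult_1)
qed

lemma op_powr_half_unconj:
  fixes X :: "'a::nonzero_chilbert_space operator"
  assumes "posdef X"
  shows "op_powr X (1/2) * (op_powr X (-1/2) * A * op_powr X (-1/2)) * op_powr X (1/2) = A"
proof -
  have "op_powr X (1/2) * (op_powr X (-1/2) * A * op_powr X (-1/2)) * op_powr X (1/2)
      = (op_powr X (1/2) * op_powr X (-1/2)) * A * (op_powr X (-1/2) * op_powr X (1/2))"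
    by (simp only: mult.assoc)
  then show ?thesis by (simp only: op_powr_half_conj[OF assms] mult_1 mult_1_right)
qed

lemma geo_mean_scaleR_left:
  fixes X A :: "'a::nonzero_chilbert_space operator"
  assumes X: "posdef X" and A: "posdef A" and c: "0 < c"
  shows "geo_mean t (c *\<^sub>R X) A = c powr (1 - t) *\<^sub>R geo_mean t X A"
proof -
  define C where "C = op_powr X (-1/2) * A * op_powr X (-1/2)"
  have C: "posdef C" unfolding C_def by (intro posdef_conj posdef_op_powr X A)
  have "op_powr (c *\<^sub>R X) (-1/2) * A * op_powr (c *\<^sub>R X) (-1/2) = (c powr (-1/2) * c powr (-1/2)) *\<^sub>R C"
    unfolding op_powr_scaleR[OF X c] C_def
    by (simp only: mult_scaleR_left mult_scaleR_right scaleR_scaleR)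
  also have "c powr (-1/2) * c powr (-1/2) = c powr (-1)" by (simp flip: powr_add)
  finally have *: "op_powr (c *\<^sub>R X) (-1/2) * A * op_powr (c *\<^sub>R X) (-1/2) = c powr (-1) *\<^sub>R C" .
  have "0 < c powr (-1)" using c by simp
  then have "geo_mean t (c *\<^sub>R X) A
      = (c powr (1/2) * (c powr (-1)) powr t * c powr (1/2)) *\<^sub>R geo_mean t X A"
    unfolding geo_mean_def * unfolding C_def[symmetric] op_powr_scaleR[OF X c]
    unfolding op_powr_scaleR[OF C \<open>0 < c powr (-1)\<close>]
    by (simp only: mult_scaleR_left mult_scaleR_right scaleR_scaleR mult.commute mult.left_commute)
  also have "c powr (1/2) * (c powr (-1)) powr t * c powr (1/2) = c powr (1/2 + (- t) + 1/2)"
  proof -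
    have "(c powr (-1)) powr t = c powr (- t)" by (simp only: powr_powr mult_minus1)
    then show ?thesis by (simp only: powr_add)
  qed
  also have "1/2 + (- t) + 1/2 = 1 - t" by (simp add: field_simps)
  finally show ?thesis .
qed

text \<open>With \<open>T = A\<^bsup>1/2\<^esup>X\<^bsup>-1/2\<^esup>\<close> and \<open>T'\<close> its adjoint, \<open>T'T\<close> is the operator \<open>C\<close> in
  \<open>X \<sharp>\<^sub>t A = X\<^bsup>1/2\<^esup>C\<^bsup>t\<^esup>X\<^bsup>1/2\<^esup>\<close>, while \<open>TT'\<close> is the inverse of \<open>A\<^bsup>-1/2\<^esup>XA\<^bsup>-1/2\<^esup>\<close>; the functional
  calculi of \<open>T'T\<close> and \<open>TT'\<close> are intertwined by \<open>T\<close>.\<close>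

lemma geo_mean_swap:
  fixes X A :: "'a::nonzero_chilbert_space operator"
  assumes X: "posdef X" and A: "posdef A"
  shows "geo_mean t X A = geo_mean (1 - t) A X"
proof -
  define P where "P = op_powr X (1/2)"
  define P' where "P' = op_powr X (-1/2)"
  define R where "R = op_powr A (1/2)"
  define R' where "R' = op_powr A (-1/2)"
  define C where "C = P' * A * P'"
  define D where "D = R' * X * R'"
  define E where "E = R * (P' * P') * R"
  note P = op_powr_half_conj[OF X, folded P_def P'_def]
    and R = op_powr_half_conj[OF A, folded R_def R'_def]
  have C: "posdef C" unfolding C_def P'_def by (intro posdef_conj posdef_op_powr X A)
  have E: "posdef E" unfolding E_def P'_def R_def op_powr_add[OF X]
    by (intro posdef_conj posdef_op_powr X A)
  have "D * E = R' * X * (R' * R) * (P' * P') * R" by (simp only: D_def E_def mult.assoc)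
  also have "\<dots> = R' * (P * P) * 1 * (P' * P') * R" by (simp only: P(1) R(3))
  also have "\<dots> = R' * P * (P * P') * P' * R" by (simp only: mult.assoc mult_1_left)
  also have "\<dots> = R' * P * 1 * P' * R" by (simp only: P(2))
  also have "\<dots> = R' * (P * P') * R" by (simp only: mult.assoc mult_1_left)
  also have "\<dots> = 1" by (simp only: P(2) R(3) mult_1_right)
  finally have DE: "op_powr D (1 - t) = op_powr E (t - 1)"
    using op_powr_inverse[OF E] by simp
  have "C = P' * (R * R) * P'" by (simp only: C_def R(1))
  then have CT: "C = (P' * R) * (R * P')" by (simp only: mult.assoc)
  have "(R * P') * C = E * (R * P')" unfolding CT E_def by (simp only: mult.assoc)
  then have int: "(R * P') * op_powr C (t - 1) = op_powr E (t - 1) * (R * P')"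
    by (rule op_powr_intertwine[OF C E])
  have "op_powr C t = C * op_powr C (t - 1)"
    using op_powr_add[OF C, of 1 "t - 1"] op_powr_1[OF C] by simp
  also have "\<dots> = (P' * R) * ((R * P') * op_powr C (t - 1))"
    using CT by (metis mult.assoc)
  also have "\<dots> = (P' * R) * (op_powr E (t - 1) * (R * P'))" by (simp only: int)
  finally have "P * op_powr C t * P = (P * P') * R * (op_powr E (t - 1) * (R * P')) * P"
    by (simp only: mult.assoc)
  also have "\<dots> = 1 * R * (op_powr E (t - 1) * (R * P')) * P" by (simp only: P(2))
  also have "\<dots> = R * op_powr E (t - 1) * R * (P' * P)" by (simp only: mult.assoc mult_1_left)
  also have "\<dots> = R * op_powr D (1 - t) * R" by (simp only: P(3) DE mult_1_right)
  finally show ?thesis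
    by (simp add: geo_mean_def C_def D_def P_def P'_def R_def R'_def)
qed

lemma geo_mean_mono_left:
  fixes X Y A :: "'a::nonzero_chilbert_space operator"
  assumes X: "posdef X" and Y: "posdef Y" and A: "posdef A" and le: "X \<le> Y"
    and t: "0 \<le> t" "t \<le> 1"
  shows "geo_mean t X A \<le> geo_mean t Y A"
  unfolding geo_mean_swap[OF X A] geo_mean_swap[OF Y A] unfolding geo_mean_def
  using t by (intro conj_mono op_powr_mono posdef_conj posdef_op_powr
      posdef_selfadjoint[OF posdef_op_powr] X Y A le) auto

text \<open>The order between \<open>A\<close> and \<open>X\<close> is the order between \<open>X\<^bsup>-1/2\<^esup>AX\<^bsup>-1/2\<^esup>\<close> and \<open>1\<close>, which powers preserve.\<close>

lemma geo_mean_bounds: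
  fixes X A :: "'a::nonzero_chilbert_space operator"
  assumes X: "posdef X" and A: "posdef A" and t: "0 \<le> t"
  shows "A \<le> X \<Longrightarrow> geo_mean t X A \<le> X" and "X \<le> A \<Longrightarrow> X \<le> geo_mean t X A"
proof -
  define C where "C = op_powr X (-1/2) * A * op_powr X (-1/2)"
  have C: "posdef C" unfolding C_def by (intro posdef_conj posdef_op_powr X A)
  then obtain a b where ab: "0 < a" "op_in a b C" using posdef_bounds by blast
  have sa: "selfadjoint (op_powr X u)" for u by (intro posdef_selfadjoint posdef_op_powr X)
  show "geo_mean t X A \<le> X" if "A \<le> X"
  proof -
    have "C \<le> op_powr X (-1/2) * X * op_powr X (-1/2)"
      unfolding C_def by (intro conj_mono sa that)
    also have "\<dots> = 1 *\<^sub>R 1" by (simp only: op_powr_half_conj(4)[OF X] scaleR_one)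
    finally have "op_powr C t \<le> 1"
      using op_in_op_powr[where a = a and b = 1 and T = C, OF ab(1) _ t] ab(2) by simp
    from conj_mono[OF sa this, of "1/2"] show ?thesis
      by (simp add: geo_mean_def C_def op_powr_half_conj[OF X])
  qed
  show "X \<le> geo_mean t X A" if "X \<le> A"
  proof -
    have "1 *\<^sub>R 1 = op_powr X (-1/2) * X * op_powr X (-1/2)"
      by (simp only: op_powr_half_conj(4)[OF X] scaleR_one)
    also have "\<dots> \<le> C" unfolding C_def by (intro conj_mono sa that)
    finally have "1 \<le> op_powr C t"
      using op_in_op_powr[where a = 1 and b = b and T = C, OF _ _ t] ab(2) by simp
    from conj_mono[OF sa this, of "1/2"] show ?thesis
      by (simp add: geo_mean_def C_def op_powr_half_conj[OF X])
  qed
qed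

section \<open>The weighted power mean as a fixed point\<close>

locale weighted_tuple =
  fixes n :: nat and t :: real and w :: "nat \<Rightarrow> real"
    and A :: "nat \<Rightarrow> 'a::nonzero_chilbert_space operator"
  assumes t: "0 < t" "t \<le> 1"
    and posdef_A: "i \<in> {1..n} \<Longrightarrow> posdef (A i)"
    and w_pos: "i \<in> {1..n} \<Longrightarrow> 0 < w i"
    and w_sum: "(\<Sum>i=1..n. w i) = 1"
begin

definition mean_map :: "'a operator \<Rightarrow> 'a operator"
  where "mean_map X = (\<Sum>i=1..n. w i *\<^sub>R geo_mean t X (A i))"

lemma w_nonneg: "i \<in> {1..n} \<Longrightarrow> 0 \<le> w i"
  using w_pos by (rule order_less_imp_le)

lemma n_pos: "1 \<in> {1..n}"
  using w_sum by (cases n) auto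

lemma weighted_const: "(\<Sum>i=1..n. w i *\<^sub>R Z) = Z" for Z :: "'a operator"
  using w_sum by (simp flip: scaleR_sum_left)

lemma mean_map_mono:
  assumes "posdef X" "posdef Y" "X \<le> Y" shows "mean_map X \<le> mean_map Y"
  unfolding mean_map_def
proof (intro sum_mono scaleR_left_mono)
  fix i assume i: "i \<in> {1..n}"
  then show "geo_mean t X (A i) \<le> geo_mean t Y (A i)" "0 \<le> w i"
    using geo_mean_mono_left[OF assms(1,2) posdef_A[OF i] assms(3)] t w_pos[OF i] by simp_all
qed

lemma posdef_mean_map:
  assumes "posdef X" shows "posdef (mean_map X)"
proof (rule posdef_mono)
  show "posdef (w 1 *\<^sub>R geo_mean t X (A 1))"
    using n_pos by (intro posdef_scaleR posdef_geo_mean assms posdef_A w_pos)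
  have "0 \<le> w i *\<^sub>R geo_mean t X (A i)" if "i \<in> {1..n}" for i
    using that w_pos[OF that]
    by (intro scaleR_nonneg_nonneg posdef_nonneg posdef_geo_mean assms posdef_A) simp_all
  then have "0 \<le> (\<Sum>i\<in>{1..n} - {1}. w i *\<^sub>R geo_mean t X (A i))"
    by (intro sum_nonneg) blast
  then show "w 1 *\<^sub>R geo_mean t X (A 1) \<le> mean_map X"
    unfolding mean_map_def sum.remove[OF finite_atLeastAtMost n_pos] by simp
qed

lemma mean_map_scaleR:
  assumes "posdef X" "0 < c" shows "mean_map (c *\<^sub>R X) = c powr (1 - t) *\<^sub>R mean_map X"
  unfolding mean_map_def scaleR_sum_right
proof (rule sum.cong[OF refl])
  fix i assume "i \<in> {1..n}"
  then show "w i *\<^sub>R geo_mean t (c *\<^sub>R X) (A i) = c powr (1 - t) *\<^sub>R w i *\<^sub>R geo_mean t X (A i)"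
    by (simp add: geo_mean_scaleR_left[OF assms(1) posdef_A assms(2)])
qed

lemma mean_map_bounds:
  assumes Z: "posdef Z"
  shows "(\<And>i. i \<in> {1..n} \<Longrightarrow> A i \<le> Z) \<Longrightarrow> mean_map Z \<le> Z"
    and "(\<And>i. i \<in> {1..n} \<Longrightarrow> Z \<le> A i) \<Longrightarrow> Z \<le> mean_map Z"
proof -
  have t0: "0 \<le> t" using t by simp
  show "mean_map Z \<le> Z" if "\<And>i. i \<in> {1..n} \<Longrightarrow> A i \<le> Z"
  proof -
    have "mean_map Z \<le> (\<Sum>i=1..n. w i *\<^sub>R Z)"
      unfolding mean_map_def
      by (intro sum_mono scaleR_left_mono geo_mean_bounds(1)[OF Z posdef_A t0] that w_nonneg)
    then show ?thesis by (simp only: weighted_const)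
  qed
  show "Z \<le> mean_map Z" if "\<And>i. i \<in> {1..n} \<Longrightarrow> Z \<le> A i"
  proof -
    have "(\<Sum>i=1..n. w i *\<^sub>R Z) \<le> mean_map Z"
      unfolding mean_map_def
      by (intro sum_mono scaleR_left_mono geo_mean_bounds(2)[OF Z posdef_A t0] that w_nonneg)
    then show ?thesis by (simp only: weighted_const)
  qed
qed

lemma gap_tendsto_one:
  assumes "0 < c" shows "(\<lambda>k. c powr ((1 - t) ^ k)) \<longlonglongrightarrow> 1"
proof -
  have "(\<lambda>k. (1 - t) ^ k) \<longlonglongrightarrow> 0" using t by (intro LIMSEQ_power_zero) simp
  then have "(\<lambda>k. c powr ((1 - t) ^ k)) \<longlonglongrightarrow> c powr 0"
    using assms by (intro tendsto_powr tendsto_const) auto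
  then show ?thesis using assms by simp
qed

text \<open>If \<open>\<alpha> Q \<le> Z\<close> for some \<open>\<alpha> > 0\<close>, then applying the monotone map, which is homogeneous of
  degree \<open>1 - t\<close>, gives \<open>\<alpha>\<^bsup>1-t\<^esup> Q \<le> Z\<close>.  Iterating this drives the factor to \<open>1\<close>.\<close>

lemma subsolution_le_supersolution:
  assumes Z: "posdef Z" "mean_map Z \<le> Z" and Q: "posdef Q" "Q \<le> mean_map Q"
  shows "Q \<le> Z"
proof -
  obtain a b where ab: "0 < a" "op_in a b Z" using Z(1) posdef_bounds by blast
  obtain c d where cd: "0 < c" "op_in c d Q" using Q(1) posdef_bounds by blast
  have d: "0 < d" using cd(1) op_in_le[OF cd(2)] by linarith
  define \<alpha> where "\<alpha> = a / d"
  have \<alpha>: "0 < \<alpha>" using ab(1) d by (simp add: \<alpha>_def)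
  have le: "\<alpha> powr ((1 - t) ^ k) *\<^sub>R Q \<le> Z" for k
  proof (induction k)
    case 0
    have "\<alpha> *\<^sub>R Q \<le> \<alpha> *\<^sub>R (d *\<^sub>R 1)"
      using cd(2) \<alpha> by (intro scaleR_left_mono) simp_all
    also have "\<dots> = a *\<^sub>R 1" using d by (simp add: \<alpha>_def)
    also have "\<dots> \<le> Z" using ab(2) by simp
    finally show ?case using \<alpha> by simp
  next
    case (Suc k)
    define \<beta> where "\<beta> = \<alpha> powr ((1 - t) ^ k)"
    have \<beta>: "0 < \<beta>" using \<alpha> by (simp add: \<beta>_def)
    have "\<beta> powr (1 - t) *\<^sub>R Q \<le> \<beta> powr (1 - t) *\<^sub>R mean_map Q"
      using Q(2) by (intro scaleR_left_mono) simp_all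
    also have "\<dots> = mean_map (\<beta> *\<^sub>R Q)" by (rule mean_map_scaleR[OF Q(1) \<beta>, symmetric])
    also have "\<dots> \<le> mean_map Z"
      using Suc.IH by (intro mean_map_mono posdef_scaleR Q(1) \<beta> Z(1)) (simp add: \<beta>_def)
    also have "\<dots> \<le> Z" by (rule Z(2))
    finally show ?case by (simp add: \<beta>_def powr_powr mult.commute)
  qed
  have "(\<lambda>k. \<alpha> powr ((1 - t) ^ k) *\<^sub>R Q) \<longlonglongrightarrow> 1 *\<^sub>R Q"
    by (intro tendsto_scaleR gap_tendsto_one \<alpha> tendsto_const)
  from op_tendsto_le[OF this tendsto_const le] show ?thesis by simp
qed

text \<open>Iterating from a multiple of the identity below all \<open>A\<^sub>i\<close> and from one above gives an
  increasing sequence \<open>Y\<close> and a decreasing sequence \<open>Z\<close> with \<open>Y\<^sub>k \<le> Z\<^sub>k \<le> c\<^bsup>(1-t)\<^sup>k\<^esup> Y\<^sub>k\<close>.  The limit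
  of \<open>Y\<close> and its image both lie between \<open>Y\<^sub>k\<close> and \<open>Z\<^sub>k\<close> for all \<open>k\<close>, so they are equal.\<close>

lemma ex_fixed_point: "\<exists>X. posdef X \<and> mean_map X = X"
proof -
  have "\<exists>a b. 0 < a \<and> op_in a b (A i)" if "i \<in> {1..n}" for i
    using posdef_bounds[OF posdef_A[OF that]] by metis
  then obtain a b where ab: "\<And>i. i \<in> {1..n} \<Longrightarrow> 0 < a i \<and> op_in (a i) (b i) (A i)" by metis
  define m where "m = Min (a ` {1..n})"
  define M where "M = Max (b ` {1..n})"
  have ne: "a ` {1..n} \<noteq> {}" "b ` {1..n} \<noteq> {}" using n_pos by blast+
  have m: "0 < m" unfolding m_def using ne(1) ab by (subst Min_gr_iff) auto
  have mA: "m *\<^sub>R 1 \<le> A i" if "i \<in> {1..n}" for i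
  proof (rule order_trans[OF scaleR_one_mono])
    show "m \<le> a i" unfolding m_def using that by (intro Min_le) simp_all
  qed (use ab[OF that] in blast)
  have AM: "A i \<le> M *\<^sub>R 1" if "i \<in> {1..n}" for i
  proof (rule order_trans[OF _ scaleR_one_mono])
    show "b i \<le> M" unfolding M_def using that by (intro Max_ge) simp_all
  qed (use ab[OF that] in blast)
  have mM: "m \<le> M" using order_trans[OF mA AM] n_pos scaleR_one_le_imp_le by blast
  then have M: "0 < M" using m by linarith
  define c where "c = M / m"
  have c: "0 < c" "c * m = M" using m M by (simp_all add: c_def)
  define Y where "Y k = (mean_map ^^ k) (m *\<^sub>R 1)" for k
  define Z where "Z k = (mean_map ^^ k) (M *\<^sub>R 1)" for k
  have Y0: "Y 0 = m *\<^sub>R 1" and YS: "Y (Suc k) = mean_map (Y k)" for k by (simp_all add: Y_def)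
  have Z0: "Z 0 = M *\<^sub>R 1" and ZS: "Z (Suc k) = mean_map (Z k)" for k by (simp_all add: Z_def)
  have pd1: "posdef (r *\<^sub>R (1 :: 'a operator))" if "0 < r" for r
    using that posdef_iff by blast
  have pY: "posdef (Y k)" for k
    by (induction k) (simp_all add: Y0 YS pd1 m posdef_mean_map)
  have pZ: "posdef (Z k)" for k
    by (induction k) (simp_all add: Z0 ZS pd1 M posdef_mean_map)
  have Yinc: "Y k \<le> Y (Suc k)" for k
  proof (induction k)
    case 0
    show ?case unfolding YS Y0 by (intro mean_map_bounds(2) pd1 m mA)
  next
    case (Suc k)
    have "mean_map (Y k) \<le> mean_map (Y (Suc k))" by (intro mean_map_mono pY Suc.IH)
    then show ?case by (simp only: YS)
  qed
  have Zdec: "Z (Suc k) \<le> Z k" for k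
  proof (induction k)
    case 0
    show ?case unfolding ZS Z0 by (intro mean_map_bounds(1) pd1 M AM)
  next
    case (Suc k)
    have "mean_map (Z (Suc k)) \<le> mean_map (Z k)" by (intro mean_map_mono pZ Suc.IH)
    then show ?case by (simp only: ZS)
  qed
  have YZ: "Y k \<le> Z k" for k
  proof (induction k)
    case 0
    show ?case using mM by (simp add: Y0 Z0 scaleR_one_mono)
  next
    case (Suc k)
    show ?case unfolding YS ZS by (intro mean_map_mono pY pZ Suc.IH)
  qed
  have ZY: "Z k \<le> c powr ((1 - t) ^ k) *\<^sub>R Y k" for k
  proof (induction k)
    case 0
    show ?case using c by (simp add: Y0 Z0)
  next
    case (Suc k)
    define \<beta> where "\<beta> = c powr ((1 - t) ^ k)"
    have \<beta>: "0 < \<beta>" using c by (simp add: \<beta>_def)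
    have "mean_map (Z k) \<le> mean_map (\<beta> *\<^sub>R Y k)"
      using Suc.IH by (intro mean_map_mono posdef_scaleR pZ pY \<beta>) (simp add: \<beta>_def)
    also have "\<dots> = \<beta> powr (1 - t) *\<^sub>R mean_map (Y k)" by (rule mean_map_scaleR[OF pY \<beta>])
    finally show ?case by (simp add: YS ZS \<beta>_def powr_powr mult.commute)
  qed
  have Ymono: "Y k \<le> Y l" if "k \<le> l" for k l using lift_Suc_mono_le[of Y, OF Yinc that] .
  have Zmono: "Z l \<le> Z k" if "k \<le> l" for k l using lift_Suc_antimono_le[of Z, OF Zdec that] .
  define e where "e k = \<bar>c powr ((1 - t) ^ k) - 1\<bar> * norm (Z 0)" for k
  have gap: "norm (Z k - Y k) \<le> e k" for k
  proof -
    have "Z k - Y k \<le> (c powr ((1 - t) ^ k) - 1) *\<^sub>R Y k"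
      using ZY[of k] by (simp add: scaleR_diff_left)
    then have "norm (Z k - Y k) \<le> norm ((c powr ((1 - t) ^ k) - 1) *\<^sub>R Y k)"
      using YZ[of k] by (intro norm_mono_op) simp_all
    also have "\<dots> \<le> e k" unfolding e_def norm_scaleR
      using order_trans[OF YZ Zmono, of 0 k]
      by (intro mult_left_mono norm_mono_op posdef_nonneg pY) simp_all
    finally show ?thesis .
  qed
  have e0: "e \<longlonglongrightarrow> 0"
  proof -
    have "(\<lambda>k. \<bar>c powr ((1 - t) ^ k) - 1\<bar> * norm (Z 0)) \<longlonglongrightarrow> \<bar>1 - 1\<bar> * norm (Z 0)"
      by (intro tendsto_intros gap_tendsto_one c)
    then show ?thesis by (simp add: e_def[abs_def])
  qed
  \<comment> \<open>Anything between \<open>Y\<^sub>k\<close> and \<open>Z\<^sub>k\<close> is within the gap of \<open>Y\<^sub>k\<close>.\<close>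
  have near: "norm (S - Y k) \<le> e k" if "Y k \<le> S" "S \<le> Z k" for S k
    using norm_mono_op[of "S - Y k" "Z k - Y k"] gap[of k] that by simp
  have "Cauchy Y"
  proof (rule metric_CauchyI)
    fix r :: real assume "0 < r"
    then obtain N where N: "e N < r/2"
      using order_tendstoD(2)[OF e0, of "r/2"] unfolding eventually_sequentially by auto
    have "norm (Y k - Y N) < r/2" if "k \<ge> N" for k
      using near[OF Ymono[OF that] order_trans[OF YZ Zmono[OF that]]] N by linarith
    then have "dist (Y k) (Y N) < r/2" if "k \<ge> N" for k using that by (simp add: dist_norm)
    then show "\<exists>N. \<forall>k\<ge>N. \<forall>l\<ge>N. dist (Y k) (Y l) < r"
      using dist_triangle_half_l by blast
  qed
  then obtain L where L: "Y \<longlonglongrightarrow> L" by (meson Cauchy_convergent convergent_def)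
  have YL: "Y k \<le> L" for k
    using op_tendsto_le[OF tendsto_const LIMSEQ_ignore_initial_segment[OF L, of k], of "Y k"]
    by (simp add: Ymono)
  have LZ: "L \<le> Z k" for k
    using op_tendsto_le[OF LIMSEQ_ignore_initial_segment[OF L, of k] tendsto_const, of "Z k"]
      order_trans[OF YZ Zmono[of k]] by simp
  have pL: "posdef L" using posdef_mono[OF pY YL] .
  have "norm (mean_map L - L) \<le> 2 * e (Suc k)" for k
  proof -
    have "norm (mean_map L - Y (Suc k)) \<le> e (Suc k)"
    proof (rule near)
      show "Y (Suc k) \<le> mean_map L" unfolding YS by (intro mean_map_mono pY pL YL)
      show "mean_map L \<le> Z (Suc k)" unfolding ZS by (intro mean_map_mono pZ pL LZ)
    qed
    moreover have "norm (L - Y (Suc k)) \<le> e (Suc k)" by (rule near[OF YL LZ])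
    ultimately show ?thesis
      using norm_triangle_ineq4[of "mean_map L - Y (Suc k)" "L - Y (Suc k)"] by simp
  qed
  moreover have "(\<lambda>k. 2 * e (Suc k)) \<longlonglongrightarrow> 2 * 0"
    by (intro tendsto_mult tendsto_const LIMSEQ_Suc e0)
  ultimately have "norm (mean_map L - L) \<le> 0"
    by (intro LIMSEQ_le_const[of "\<lambda>k. 2 * e (Suc k)" 0]) auto
  then show ?thesis using pL by auto
qed

lemma power_mean_fixed_point:
  shows posdef_power_mean: "posdef (power_mean n t w A)"
    and mean_map_power_mean: "mean_map (power_mean n t w A) = power_mean n t w A"
proof -
  obtain X where X: "posdef X" "mean_map X = X" using ex_fixed_point by blast
  have "power_mean n t w A = X"
    unfolding power_mean_def mean_map_def[symmetric]
  proof (rule the_equality)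
    show "posdef X \<and> X = mean_map X" using X by simp
    fix Y assume "posdef Y \<and> Y = mean_map Y"
    then have Y: "posdef Y" "mean_map Y = Y" by simp_all
    show "Y = X"
    proof (rule antisym)
      show "Y \<le> X" by (rule subsolution_le_supersolution) (simp_all only: X Y order_refl)
      show "X \<le> Y" by (rule subsolution_le_supersolution) (simp_all only: X Y order_refl)
    qed
  qed
  with X show "posdef (power_mean n t w A)" "mean_map (power_mean n t w A) = power_mean n t w A"
    by simp_all
qed

text \<open>All \<open>A\<^sub>j\<close> lie below \<open>\<rho> A\<^sub>i\<close>, which is therefore a supersolution, and above \<open>A\<^sub>i / \<rho>\<close>, which is a
  subsolution.\<close>

lemma power_mean_ratio_bounds:
  assumes \<rho>: "0 < \<rho>" and le: "\<And>i j. i \<in> {1..n} \<Longrightarrow> j \<in> {1..n} \<Longrightarrow> A j \<le> \<rho> *\<^sub>R A i"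
    and i: "i \<in> {1..n}"
  shows "power_mean n t w A \<le> \<rho> *\<^sub>R A i" and "A i \<le> \<rho> *\<^sub>R power_mean n t w A"
proof -
  have pA: "posdef (r *\<^sub>R A i)" if "0 < r" for r by (rule posdef_scaleR[OF posdef_A[OF i] that])
  show "power_mean n t w A \<le> \<rho> *\<^sub>R A i"
  proof (rule subsolution_le_supersolution[OF pA[OF \<rho>] _ posdef_power_mean])
    show "mean_map (\<rho> *\<^sub>R A i) \<le> \<rho> *\<^sub>R A i" by (rule mean_map_bounds(1)[OF pA[OF \<rho>] le[OF i]])
  qed (simp only: mean_map_power_mean order_refl)
  have r: "0 < 1/\<rho>" using \<rho> by simp
  have "(1/\<rho>) *\<^sub>R A i \<le> power_mean n t w A"
  proof (rule subsolution_le_supersolution[OF posdef_power_mean _ pA[OF r]])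
    show "(1/\<rho>) *\<^sub>R A i \<le> mean_map ((1/\<rho>) *\<^sub>R A i)"
    proof (rule mean_map_bounds(2)[OF pA[OF r]])
      fix j assume "j \<in> {1..n}"
      from scaleR_left_mono[OF le[OF this i], of "1/\<rho>"] show "(1/\<rho>) *\<^sub>R A i \<le> A j"
        using \<rho> by simp
    qed
  qed (simp only: mean_map_power_mean order_refl)
  from scaleR_left_mono[OF this, of \<rho>] show "A i \<le> \<rho> *\<^sub>R power_mean n t w A"
    using \<rho> by simp
qed

end

section \<open>A scalar estimate\<close>

text \<open>Compare \<open>exp\<close> with its tangent at the weighted mean \<open>m\<close>.\<close>

lemma exp_weighted_mean_le:
  fixes t q :: real
  assumes "0 \<le> t" "0 \<le> q" "t + q = 1"
  shows "exp (t * x + q * y) \<le> t * exp x + q * exp y"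
proof -
  define m where "m = t * x + q * y"
  have *: "exp m * (1 + (z - m)) \<le> exp z" for z
    using mult_left_mono[OF exp_ge_add_one_self[of "z - m"], of "exp m"]
    by (simp flip: exp_add)
  have "exp m = exp m * (t * (1 + (x - m)) + q * (1 + (y - m)))"
  proof -
    have "t * (1 + (x - m)) + q * (1 + (y - m)) = (t + q) * (1 - m) + m"
      unfolding m_def by (simp add: algebra_simps)
    then show ?thesis by (simp add: assms)
  qed
  also have "\<dots> = t * (exp m * (1 + (x - m))) + q * (exp m * (1 + (y - m)))"
    by (simp only: distrib_left mult.left_commute)
  also have "\<dots> \<le> t * exp x + q * exp y"
    by (intro add_mono mult_left_mono * assms)
  finally show ?thesis by (simp add: m_def)
qed

text \<open>Both sides vanish at \<open>p = 0\<close>, so it suffices to compare the derivatives in \<open>p\<close>.  There the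
  weighted arithmetic--geometric mean inequality eliminates \<open>s\<close> and leaves
  \<open>cosh ((t\<^sup>2 + q\<^sup>2) p)\<close>, and \<open>t\<^sup>2 + q\<^sup>2 \<ge> 1/2\<close>.\<close>

lemma sinh_chord_bound:
  fixes t q p s :: real
  assumes tq: "0 \<le> t" "0 \<le> q" "t + q = 1" and p: "0 \<le> p"
  shows "2 * sinh (p/2) \<le> exp (q * s) * sinh (t * p) + exp (- t * s) * sinh (q * p)"
proof -
  define g where "g p = exp (q * s) * sinh (t * p) + exp (- t * s) * sinh (q * p) - 2 * sinh (p/2)" for p
  define g' where "g' p = t * exp (q * s) * cosh (t * p) + q * exp (- t * s) * cosh (q * p) - cosh (p/2)" for p
  have g': "(g has_real_derivative g' x) (at x)" for x
    unfolding g_def g'_def by (auto intro!: derivative_eq_intros)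
  have g'_nonneg: "0 \<le> g' x" if "0 \<le> x" for x
  proof -
    define r where "r = t * t + q * q"
    have jensen: "exp (r * y) \<le> t * exp (q * s + t * y) + q * exp (- t * s + q * y)" for y
      using exp_weighted_mean_le[OF tq, of "q * s + t * y" "- t * s + q * y"]
      by (simp add: r_def algebra_simps)
    have "0 \<le> (t - q)\<^sup>2" by simp
    then have "(t + q)\<^sup>2 \<le> 2 * r" by (simp add: r_def power2_eq_square algebra_simps)
    then have r: "1/2 \<le> r" by (simp add: tq)
    have "cosh (x/2) \<le> cosh (r * x)"
      using that mult_right_mono[OF r that] r by (subst cosh_real_nonneg_le_iff) simp_all
    also have "\<dots> = (exp (r * x) + exp (r * (- x))) / 2" by (simp add: cosh_def)
    also have "\<dots> \<le> ((t * exp (q * s + t * x) + q * exp (- t * s + q * x))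
        + (t * exp (q * s + t * (- x)) + q * exp (- t * s + q * (- x)))) / 2"
      by (intro divide_right_mono add_mono jensen) simp
    also have "\<dots> = t * exp (q * s) * cosh (t * x) + q * exp (- t * s) * cosh (q * x)"
    proof -
      have cosh: "cosh (t * x) = (exp (t * x) + exp (t * (- x))) / 2"
        "cosh (q * x) = (exp (q * x) + exp (q * (- x))) / 2" by (simp_all add: cosh_def)
      have "((t * (a * e1) + q * (b * f1)) + (t * (a * e2) + q * (b * f2))) / 2
          = t * a * ((e1 + e2) / 2) + q * b * ((f1 + f2) / 2)" for a b e1 e2 f1 f2 :: real
        by (simp add: field_simps)
      then show ?thesis unfolding exp_add cosh .
    qed
    finally show ?thesis unfolding g'_def by linarith
  qed
  have "g 0 \<le> g p"
    by (rule DERIV_nonneg_imp_nondecreasing[OF p]) (use g' g'_nonneg in blast)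
  then show ?thesis by (simp add: g_def)
qed

lemma kantorovich_half_square:
  assumes "1 \<le> \<rho>" shows "kantorovich_half (\<rho>\<^sup>2) = 1 / cosh (ln \<rho> / 2)"
proof -
  have \<rho>: "0 < \<rho>" using assms by simp
  define u where "u = \<rho> powr (1/2)"
  have u: "0 < u" using \<rho> by (simp add: u_def)
  have uu: "u * u = \<rho>" using \<rho> by (simp add: u_def flip: powr_add)
  have sq: "\<rho>\<^sup>2 = \<rho> powr 2" using \<rho> by simp
  have "(\<rho>\<^sup>2) powr (1/4) = u" "(\<rho>\<^sup>2) powr (1/2) = \<rho>"
    unfolding sq powr_powr u_def using \<rho> by simp_all
  then have K: "kantorovich_half (\<rho>\<^sup>2) = 2 * u / (1 + \<rho>)" by (simp add: kantorovich_half_def)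
  have "exp (ln \<rho> / 2) = u" using \<rho> by (simp add: u_def powr_def)
  then have "cosh (ln \<rho> / 2) = (u + 1/u) / 2" by (simp add: cosh_def exp_minus inverse_eq_divide)
  also have "\<dots> = (1 + \<rho>) / (2 * u)" using u uu by (simp add: field_simps)
  finally show ?thesis using K by simp
qed

text \<open>The affine function is the chord of \<open>x\<^sup>t\<close>.  It lies below \<open>x\<^sup>t\<close> by concavity.  With
  \<open>x = exp s\<close> and \<open>\<rho> = exp p\<close> its coefficients are quotients of hyperbolic sines, and the lower bound
  \<open>x\<^sup>t / cosh (p/2)\<close> becomes \<open>sinh_chord_bound\<close>.  For \<open>\<rho> = 1\<close> the chord degenerates to the constant
  \<open>1\<close>.\<close>

lemma kantorovich_affine_sandwich:
  assumes \<rho>: "1 \<le> \<rho>" and t: "0 < t" "t \<le> 1"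
  shows "\<exists>c d. \<forall>x\<in>{1/\<rho>..\<rho>}. kantorovich_half (\<rho>\<^sup>2) * x powr t \<le> c + x * d \<and> c + x * d \<le> x powr t"
proof (cases "\<rho> = 1")
  case True
  then show ?thesis
    using kantorovich_half_square[of 1] by (intro exI[of _ 1] exI[of _ 0]) simp
next
  case False
  define p where "p = ln \<rho>"
  define q where "q = 1 - t"
  have p: "0 < p" using \<rho> False by (simp add: p_def)
  have ep: "exp p = \<rho>" "exp (- p) = 1/\<rho>"
    using \<rho> by (simp_all add: p_def exp_minus inverse_eq_divide)
  have shp: "0 < sinh p" "0 < sinh (p/2)" "0 < cosh (p/2)" using p by simp_all
  have sinh2: "sinh p = 2 * sinh (p/2) * cosh (p/2)"
    using sinh_double[of "p/2"] by simp
  define c where "c = sinh (q * p) / sinh p"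
  define d where "d = sinh (t * p) / sinh p"
  \<comment> \<open>The affine function takes the values of \<open>x\<^sup>t\<close> at the end points of the interval.\<close>
  have ends: "c + exp p * d = exp (t * p)" "c + exp (- p) * d = exp (- t * p)"
  proof -
    have "sinh (q * p) = sinh p * cosh (t * p) - cosh p * sinh (t * p)"
      using sinh_diff[of p "t * p"] by (simp add: q_def algebra_simps)
    moreover have "exp p = cosh p + sinh p" "exp (- p) = cosh p - sinh p"
      "exp (t * p) = cosh (t * p) + sinh (t * p)" "exp (- t * p) = cosh (t * p) - sinh (t * p)"
      by (simp_all add: cosh_plus_sinh cosh_minus_sinh)
    ultimately show "c + exp p * d = exp (t * p)" "c + exp (- p) * d = exp (- t * p)"
      unfolding c_def d_def using shp(1) by (simp_all only:) (simp_all add: field_simps)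
  qed
  have "kantorovich_half (\<rho>\<^sup>2) * x powr t \<le> c + x * d \<and> c + x * d \<le> x powr t"
    if x: "x \<in> {1/\<rho>..\<rho>}" for x
  proof
    have x0: "0 < x"
    proof -
      have "0 < 1/\<rho>" using \<rho> by simp
      then show ?thesis using x unfolding atLeastAtMost_iff by linarith
    qed
    define s where "s = ln x"
    have xs: "x = exp s" "x powr t = exp (t * s)" using x0 by (simp_all add: s_def powr_def)
    have "2 * sinh (p/2) * exp (t * s)
        \<le> (exp (q * s) * sinh (t * p) + exp (- t * s) * sinh (q * p)) * exp (t * s)"
      using t p by (intro mult_right_mono sinh_chord_bound) (simp_all add: q_def)
    also have "\<dots> = (exp (q * s) * exp (t * s)) * sinh (t * p) + (exp (- t * s) * exp (t * s)) * sinh (q * p)"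
      by (simp add: distrib_right)
    also have "exp (q * s) * exp (t * s) = x"
    proof -
      have "q * s + t * s = s" by (simp add: q_def algebra_simps)
      then show ?thesis by (simp only: exp_add[symmetric] xs(1))
    qed
    also have "exp (- t * s) * exp (t * s) = 1" by (simp flip: exp_add)
    finally have "2 * sinh (p/2) * exp (t * s) / sinh p \<le> (x * sinh (t * p) + 1 * sinh (q * p)) / sinh p"
      using shp(1) by (intro divide_right_mono) simp_all
    also have "\<dots> = c + x * d" by (simp add: c_def d_def add_divide_distrib)
    also have "2 * sinh (p/2) * exp (t * s) / sinh p = kantorovich_half (\<rho>\<^sup>2) * x powr t"
      unfolding kantorovich_half_square[OF \<rho>] p_def[symmetric] xs(2) sinh2 using shp by simp
    finally show "kantorovich_half (\<rho>\<^sup>2) * x powr t \<le> c + x * d" .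

    define u where "u = (x - exp (- p)) / (exp p - exp (- p))"
    have den: "0 < exp p - exp (- p)" using p by simp
    have u: "0 \<le> u" "u \<le> 1"
      using x den unfolding u_def ep by (simp_all add: divide_le_eq le_divide_eq)
    have xu: "x = (1 - u) * exp (- p) + u * exp p"
    proof -
      have "u * (exp p - exp (- p)) = x - exp (- p)" using den by (simp add: u_def)
      then show ?thesis by (simp add: algebra_simps)
    qed
    \<comment> \<open>The tangent of the concave function \<open>y\<^sup>t\<close> at \<open>x\<close>, from Young's inequality.\<close>
    have tangent: "y powr t * x powr (1 - t) \<le> t * y + (1 - t) * x" if "0 < y" for y
      using t that x0 by (intro Youngs_inequality_0) simp_all
    have "(c + x * d) * x powr (1 - t)
        = (1 - u) * (exp (- p) powr t * x powr (1 - t)) + u * (exp p powr t * x powr (1 - t))"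
    proof -
      have "c + x * d = (1 - u) * (c + exp (- p) * d) + u * (c + exp p * d)"
        by (subst xu) (simp add: algebra_simps)
      also have "\<dots> = (1 - u) * exp (- p) powr t + u * exp p powr t"
        unfolding ends by (simp add: powr_def)
      finally show ?thesis by (simp only: distrib_right mult.assoc)
    qed
    also have "\<dots> \<le> (1 - u) * (t * exp (- p) + (1 - t) * x) + u * (t * exp p + (1 - t) * x)"
      using u by (intro add_mono mult_left_mono tangent) simp_all
    also have "\<dots> = t * ((1 - u) * exp (- p) + u * exp p) + (1 - t) * x" by (simp add: algebra_simps)
    also have "\<dots> = x" unfolding xu[symmetric] by (simp add: algebra_simps)
    also have "\<dots> = x powr t * x powr (1 - t)" using x0 by (simp flip: powr_add)
    finally show "c + x * d \<le> x powr t" using x0 by simp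
  qed
  then show ?thesis by blast
qed

section \<open>Spectral radius and order\<close>

text \<open>The top of the numerical range of \<open>C\<close> is the negative of the bottom of that of \<open>- C\<close>, and so lies
  in the spectrum.  The spectrum is bounded, which makes the supremum defining the spectral radius
  an upper bound.\<close>

lemma le_spectral_radius:
  fixes C :: "'a::nonzero_chilbert_space operator"
  assumes "posdef C" shows "C \<le> spectral_radius C *\<^sub>R 1"
proof -
  obtain a b where ab: "0 < a" "op_in a b C" using assms posdef_bounds by blast
  have sa: "selfadjoint C" using assms by (rule posdef_selfadjoint)
  have "cmod z \<le> b" if z: "z \<in> spectrum C" for z
  proof -
    have zr: "z = of_real (Re z)" using spectrum_real[OF sa z] by (simp add: complex_eq_iff)
    then have "Re z \<in> real_spectrum C" using z by simp
    then have "Re z \<in> {a..b}" using real_spectrum_subset[OF ab(2)] by blast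
    then have "\<bar>Re z\<bar> \<le> b" using ab(1) by simp
    then show ?thesis by (subst zr) (simp only: norm_of_real)
  qed
  then have bdd: "bdd_above (cmod ` spectrum C)" by (auto intro: bdd_aboveI[of _ b])
  have "selfadjoint (- C)" using selfadjoint_scaleR[OF sa, of "-1"] by simp
  then obtain m where m: "m \<in> real_spectrum (- C)" "m *\<^sub>R 1 \<le> - C"
    using real_spectrum_bottom by blast
  have "op_invertible (- C - m *\<^sub>R 1)" if "op_invertible (C - (- m) *\<^sub>R 1)"
    using op_invertible_scaleR[OF that, of "-1"] by (simp add: algebra_simps)
  then have "- m \<in> real_spectrum C" using m(1) unfolding real_spectrum_iff by blast
  then have "cmod (of_real (- m)) \<le> spectral_radius C"
    unfolding spectral_radius_def by (intro cSup_upper bdd imageI) simp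
  then have "- m \<le> spectral_radius C" by simp
  moreover have "C \<le> (- m) *\<^sub>R 1" using m(2) by (simp add: le_minus_iff)
  ultimately show ?thesis using order_trans scaleR_one_mono by blast
qed

lemma spectrum_similar:
  assumes VW: "V * W = 1" "W * V = 1" shows "spectrum (V * T * W) = spectrum T"
proof -
  have inv: "op_invertible V" "op_invertible W" using VW by (auto intro: op_invertibleI)
  have "op_invertible (V * T * W - z *\<^sub>C 1) \<longleftrightarrow> op_invertible (T - z *\<^sub>C 1)" for z
  proof -
    have "V * (T - z *\<^sub>C 1) * W = V * T * W - z *\<^sub>C (V * W)"
      by (simp add: algebra_simps mult_scaleC_left mult_scaleC_right)
    then have *: "V * T * W - z *\<^sub>C 1 = V * (T - z *\<^sub>C 1) * W" by (simp add: VW)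
    have "W * (V * (T - z *\<^sub>C 1) * W) * V = (W * V) * (T - z *\<^sub>C 1) * (W * V)"
      by (simp only: mult.assoc)
    then have **: "W * (V * (T - z *\<^sub>C 1) * W) * V = T - z *\<^sub>C 1" by (simp only: VW mult_1 mult_1_right)
    show ?thesis unfolding * using inv ** by (metis op_invertible_mult)
  qed
  then show ?thesis by (simp add: spectrum_def)
qed

text \<open>The operator \<open>A\<^sup>-\<^sup>1B\<close> is similar to the positive definite \<open>A\<^bsup>-1/2\<^esup>BA\<^bsup>-1/2\<^esup>\<close>.\<close>

lemma le_spectral_radius_inverse_mult:
  fixes A B :: "'a::nonzero_chilbert_space operator"
  assumes A: "posdef A" and B: "posdef B"
  shows "B \<le> spectral_radius (op_inverse A * B) *\<^sub>R A"
proof -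
  define V where "V = op_powr A (1/2)"
  define W where "W = op_powr A (-1/2)"
  define C where "C = W * B * W"
  note VW = op_powr_half_conj[OF A, folded V_def W_def]
  have sV: "selfadjoint V" unfolding V_def by (intro posdef_selfadjoint posdef_op_powr A)
  have C: "posdef C" unfolding C_def W_def by (intro posdef_conj posdef_op_powr A B)
  have "op_inverse A = W * W"
  proof (rule op_inverse_eqI)
    have "W * W * (V * V) = W * (W * V) * V" "V * V * (W * W) = V * (V * W) * W"
      by (simp_all only: mult.assoc)
    then show "W * W * A = 1" "A * (W * W) = 1" by (simp_all only: VW mult_1_right)
  qed
  then have "op_inverse A * B = W * W * B * (W * V)" by (simp only: VW mult_1_right)
  also have "\<dots> = W * C * V" by (simp only: C_def mult.assoc)
  finally have "spectral_radius (op_inverse A * B) = spectral_radius C"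
    unfolding spectral_radius_def by (simp only: spectrum_similar[OF VW(3,2)])
  then have "V * C * V \<le> V * (spectral_radius (op_inverse A * B) *\<^sub>R 1) * V"
    using le_spectral_radius[OF C] by (intro conj_mono sV) simp
  also have "\<dots> = spectral_radius (op_inverse A * B) *\<^sub>R A" by (simp add: VW(1))
  also have "V * C * V = B" unfolding C_def V_def W_def by (rule op_powr_half_unconj[OF A])
  finally show ?thesis .
qed

lemma le_ratio_bound:
  fixes A B :: "'a::nonzero_chilbert_space operator"
  assumes "posdef A" "posdef B" shows "B \<le> ratio_bound A B *\<^sub>R A"
  using le_spectral_radius_inverse_mult[OF assms]
    scaleR_right_mono[OF max.cobounded1 posdef_nonneg[OF assms(1)]]
  unfolding ratio_bound_def by (rule order_trans)

section \<open>Positive maps and geometric means\<close>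

text \<open>With \<open>C = X\<^bsup>-1/2\<^esup> A X\<^bsup>-1/2\<^esup>\<close>, whose spectrum lies in \<open>[1/\<rho>, \<rho>]\<close>, conjugation by \<open>X\<^bsup>1/2\<^esup>\<close> turns
  \<open>c + d C\<close> into \<open>c X + d A\<close> and \<open>C\<^sup>t\<close> into the geometric mean.\<close>

lemma geo_mean_affine_bounds:
  fixes X A :: "'a::nonzero_chilbert_space operator"
  assumes X: "posdef X" and A: "posdef A" and \<rho>: "0 < \<rho>"
    and le: "X \<le> \<rho> *\<^sub>R A" "A \<le> \<rho> *\<^sub>R X"
  shows "(\<And>x. x \<in> {1/\<rho>..\<rho>} \<Longrightarrow> c + x * d \<le> x powr t) \<Longrightarrow> c *\<^sub>R X + d *\<^sub>R A \<le> geo_mean t X A"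
    and "(\<And>x. x \<in> {1/\<rho>..\<rho>} \<Longrightarrow> k * x powr t \<le> c + x * d) \<Longrightarrow> k *\<^sub>R geo_mean t X A \<le> c *\<^sub>R X + d *\<^sub>R A"
proof -
  define V where "V = op_powr X (1/2)"
  define W where "W = op_powr X (-1/2)"
  define C where "C = W * A * W"
  note VW = op_powr_half_conj[OF X, folded V_def W_def]
  have sV: "selfadjoint V" and sW: "selfadjoint W"
    unfolding V_def W_def by (intro posdef_selfadjoint posdef_op_powr X)+
  have C: "posdef C" unfolding C_def W_def by (intro posdef_conj posdef_op_powr X A)
  note sC = posdef_selfadjoint[OF C]
  have "C \<le> W * (\<rho> *\<^sub>R X) * W" unfolding C_def by (intro conj_mono sW le)
  also have "\<dots> = \<rho> *\<^sub>R 1"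
    by (simp only: mult_scaleR_left mult_scaleR_right VW(4))
  finally have C1: "C \<le> \<rho> *\<^sub>R 1" .
  have "(1/\<rho>) *\<^sub>R 1 = W * ((1/\<rho>) *\<^sub>R X) * W"
    by (simp only: mult_scaleR_left mult_scaleR_right VW(4))
  also have "(1/\<rho>) *\<^sub>R X \<le> A" using scaleR_left_mono[OF le(1), of "1/\<rho>"] \<rho> by simp
  then have "W * ((1/\<rho>) *\<^sub>R X) * W \<le> C" unfolding C_def by (intro conj_mono sW)
  finally have in_C: "op_in (1/\<rho>) \<rho> C" using C1 by simp
  have cont: "continuous_on {1/\<rho>..\<rho>} (\<lambda>x. x powr t)" "continuous_on {1/\<rho>..\<rho>} (\<lambda>x. c + x * d)"
    "continuous_on {1/\<rho>..\<rho>} (\<lambda>x. k * x powr t)"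
    using \<rho> by (auto intro!: continuous_intros)
  have geo: "geo_mean t X A = V * op_powr C t * V" by (simp only: geo_mean_def C_def V_def W_def)
  have "V * C * V = A" unfolding C_def V_def W_def by (rule op_powr_half_unconj[OF X])
  then have aff: "c *\<^sub>R X + d *\<^sub>R A = V * (c *\<^sub>R 1 + d *\<^sub>R C) * V"
    by (simp add: distrib_left distrib_right VW(1))
  show "c *\<^sub>R X + d *\<^sub>R A \<le> geo_mean t X A"
    if "\<And>x. x \<in> {1/\<rho>..\<rho>} \<Longrightarrow> c + x * d \<le> x powr t"
    unfolding aff geo
  proof (rule conj_mono[OF sV])
    show "c *\<^sub>R 1 + d *\<^sub>R C \<le> op_powr C t"
      unfolding op_powr_def cfc_affine[OF sC, symmetric] by (intro cfc_mono[OF in_C] cont that)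
  qed
  show "k *\<^sub>R geo_mean t X A \<le> c *\<^sub>R X + d *\<^sub>R A"
    if "\<And>x. x \<in> {1/\<rho>..\<rho>} \<Longrightarrow> k * x powr t \<le> c + x * d"
  proof -
    have "cfc (\<lambda>x. k * x powr t) C = k *\<^sub>R op_powr C t"
      by (simp add: cfc_mult[OF in_C continuous_on_const cont(1)] cfc_const[OF sC] op_powr_def)
    then have "k *\<^sub>R op_powr C t \<le> c *\<^sub>R 1 + d *\<^sub>R C"
      using cfc_mono[OF in_C cont(3,2) that] by (simp only: cfc_affine[OF sC])
    from conj_mono[OF sV this] show ?thesis
      unfolding aff geo by (simp only: mult_scaleR_left mult_scaleR_right)
  qed
qed

lemma positive_map_simps:
  assumes "positive_map \<Phi>"
  shows positive_map_add: "\<Phi> (X + Y) = \<Phi> X + \<Phi> Y"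
    and positive_map_scaleR: "\<Phi> (r *\<^sub>R X) = r *\<^sub>R \<Phi> X"
    and positive_map_mono: "X \<le> Y \<Longrightarrow> \<Phi> X \<le> \<Phi> Y"
proof -
  have add: "\<Phi> (X + Y) = \<Phi> X + \<Phi> Y" for X Y
    using assms by (simp add: positive_map_def complex_linear_def)
  then show "\<Phi> (X + Y) = \<Phi> X + \<Phi> Y" .
  show "\<Phi> (r *\<^sub>R X) = r *\<^sub>R \<Phi> X"
    using assms by (simp add: positive_map_def complex_linear_def scaleR_scaleC)
  show "\<Phi> X \<le> \<Phi> Y" if "X \<le> Y"
  proof -
    have "0 \<le> \<Phi> (Y - X)" using assms that by (simp add: positive_map_def)
    moreover have "\<Phi> Y = \<Phi> X + \<Phi> (Y - X)" by (simp flip: add)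
    ultimately show ?thesis by simp
  qed
qed

lemma positive_map_sum:
  assumes "positive_map \<Phi>" shows "\<Phi> (\<Sum>i\<in>I. F i) = (\<Sum>i\<in>I. \<Phi> (F i))"
proof (induction I rule: infinite_finite_induct)
  case (insert i I)
  then show ?case by (simp add: positive_map_add[OF assms])
qed (use positive_map_scaleR[OF assms, of 0] in simp_all)

lemma posdef_positive_map:
  fixes \<Phi> :: "'a::nonzero_chilbert_space operator \<Rightarrow> 'b::nonzero_chilbert_space operator"
  assumes \<Phi>: "positive_map \<Phi>" "\<Phi> 1 = 1" and X: "posdef X" shows "posdef (\<Phi> X)"
proof -
  obtain c where c: "0 < c" "c *\<^sub>R 1 \<le> X" using X posdef_iff by blast
  have "c *\<^sub>R 1 \<le> \<Phi> X"
    using positive_map_mono[OF \<Phi>(1) c(2)] by (simp add: positive_map_scaleR[OF \<Phi>(1)] \<Phi>(2))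
  with c(1) show ?thesis using posdef_iff by blast
qed

text \<open>The reverse of Ando's inequality, by the method of Mond and Pecaric: an affine function
  commutes with \<open>\<Phi>\<close>, so it suffices to separate \<open>x\<^sup>t\<close> and its multiple by an affine function.\<close>

lemma positive_map_geo_mean_ge:
  fixes \<Phi> :: "'a::nonzero_chilbert_space operator \<Rightarrow> 'b::nonzero_chilbert_space operator"
  assumes \<Phi>: "positive_map \<Phi>" "\<Phi> 1 = 1" and X: "posdef X" and A: "posdef A"
    and \<rho>: "1 \<le> \<rho>" and le: "X \<le> \<rho> *\<^sub>R A" "A \<le> \<rho> *\<^sub>R X" and t: "0 < t" "t \<le> 1"
  shows "kantorovich_half (\<rho>\<^sup>2) *\<^sub>R geo_mean t (\<Phi> X) (\<Phi> A) \<le> \<Phi> (geo_mean t X A)"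
proof -
  note lin = positive_map_add[OF \<Phi>(1)] positive_map_scaleR[OF \<Phi>(1)]
  obtain c d where cd: "\<And>x. x \<in> {1/\<rho>..\<rho>} \<Longrightarrow> kantorovich_half (\<rho>\<^sup>2) * x powr t \<le> c + x * d"
    "\<And>x. x \<in> {1/\<rho>..\<rho>} \<Longrightarrow> c + x * d \<le> x powr t"
    using kantorovich_affine_sandwich[OF \<rho> t] by metis
  have \<rho>0: "0 < \<rho>" using \<rho> by simp
  have "\<Phi> X \<le> \<rho> *\<^sub>R \<Phi> A" "\<Phi> A \<le> \<rho> *\<^sub>R \<Phi> X"
    using positive_map_mono[OF \<Phi>(1) le(1)] positive_map_mono[OF \<Phi>(1) le(2)] by (simp_all add: lin)
  from geo_mean_affine_bounds(2)[OF posdef_positive_map[OF \<Phi> X] posdef_positive_map[OF \<Phi> A] \<rho>0 this cd(1)]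
  have "kantorovich_half (\<rho>\<^sup>2) *\<^sub>R geo_mean t (\<Phi> X) (\<Phi> A) \<le> c *\<^sub>R \<Phi> X + d *\<^sub>R \<Phi> A" by blast
  also have "\<dots> = \<Phi> (c *\<^sub>R X + d *\<^sub>R A)" by (simp add: lin)
  also have "\<dots> \<le> \<Phi> (geo_mean t X A)"
    by (intro positive_map_mono[OF \<Phi>(1)] geo_mean_affine_bounds(1)[OF X A \<rho>0 le] cd(2))
  finally show ?thesis .
qed

section \<open>The inequality for power means\<close>

theorem theorem3:
  fixes \<Phi> :: "'a::nonzero_chilbert_space operator \<Rightarrow> 'a operator"
    and A :: "nat \<Rightarrow> 'a operator"
    and w :: "nat \<Rightarrow> real"
    and n :: nat
    and t h0 :: real
  assumes "positive_map \<Phi>" and "\<Phi> 1 = 1"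
    and "n \<ge> 2"
    and "0 < t" and "t \<le> 1"
    and "\<And>i. i \<in> {1..n} \<Longrightarrow> posdef (A i)"
    and "\<And>i. i \<in> {1..n} \<Longrightarrow> 0 < w i \<and> w i < 1"
    and "(\<Sum>i=1..n. w i) = 1"
    and "h0 = Max {(ratio_bound (A i) (A j))\<^sup>2 | i j. i \<in> {1..n} \<and> j \<in> {1..n}}"
  shows "\<Phi> (power_mean n t w A)
           \<ge> (kantorovich_half h0 powr (1/t)) *\<^sub>R power_mean n t w (\<lambda>i. \<Phi> (A i))"
proof -
  note \<Phi> = assms(1,2) and t = assms(4,5)
  have w0: "0 < w i" if "i \<in> {1..n}" for i using assms(7)[OF that] by blast
  interpret dom: weighted_tuple n t w A
    by (rule weighted_tuple.intro[OF t assms(6) w0 assms(8)])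
  interpret img: weighted_tuple n t w "\<lambda>i. \<Phi> (A i)"
    by (rule weighted_tuple.intro[OF t posdef_positive_map[OF \<Phi> assms(6)] w0 assms(8)])
  define \<rho> where "\<rho> = sqrt h0"
  have fin: "finite {(ratio_bound (A i) (A j))\<^sup>2 | i j. i \<in> {1..n} \<and> j \<in> {1..n}}"
    by (rule finite_image_set2) simp_all
  have ratio: "(ratio_bound (A i) (A j))\<^sup>2 \<le> h0" if "i \<in> {1..n}" "j \<in> {1..n}" for i j
    unfolding assms(9) using that by (intro Max_ge[OF fin]) blast
  have A_le: "A j \<le> \<rho> *\<^sub>R A i" if "i \<in> {1..n}" "j \<in> {1..n}" for i j
  proof -
    have "ratio_bound (A i) (A j) \<le> \<rho>"
      unfolding \<rho>_def by (rule real_le_rsqrt[OF ratio[OF that]])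
    then show ?thesis
      using order_trans[OF le_ratio_bound scaleR_right_mono] assms(6) that posdef_nonneg by blast
  qed
  have h0: "h0 = \<rho>\<^sup>2"
    using order_trans[OF zero_le_power2 ratio[OF dom.n_pos dom.n_pos]] by (simp add: \<rho>_def)
  have \<rho>: "1 \<le> \<rho>"
  proof -
    define W where "W = op_powr (A 1) (-1/2)"
    have A1: "posdef (A 1)" by (rule assms(6)[OF dom.n_pos])
    have "W * A 1 * W \<le> W * (\<rho> *\<^sub>R A 1) * W"
      unfolding W_def
      by (intro conj_mono posdef_selfadjoint posdef_op_powr A1 A_le dom.n_pos)
    then have "1 *\<^sub>R (1 :: 'a operator) \<le> \<rho> *\<^sub>R 1"
      unfolding W_def by (simp only: mult_scaleR_left mult_scaleR_right op_powr_half_conj[OF A1] scaleR_one)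
    then show ?thesis by (rule scaleR_one_le_imp_le)
  qed
  define K where "K = kantorovich_half h0"
  have K0: "0 < K" unfolding K_def h0 kantorovich_half_square[OF \<rho>] by simp
  define X where "X = power_mean n t w A"
  define Q where "Q = power_mean n t w (\<lambda>i. \<Phi> (A i))"
  have X: "posdef X" "(\<Sum>i=1..n. w i *\<^sub>R geo_mean t X (A i)) = X"
    using dom.power_mean_fixed_point unfolding X_def dom.mean_map_def by blast+
  have pY: "posdef (\<Phi> X)" by (rule posdef_positive_map[OF \<Phi> X(1)])
  have "K *\<^sub>R img.mean_map (\<Phi> X) = (\<Sum>i=1..n. w i *\<^sub>R K *\<^sub>R geo_mean t (\<Phi> X) (\<Phi> (A i)))"
    by (simp add: img.mean_map_def scaleR_sum_right mult.commute)
  also have "\<dots> \<le> (\<Sum>i=1..n. w i *\<^sub>R \<Phi> (geo_mean t X (A i)))"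
  proof (intro sum_mono scaleR_left_mono)
    fix i assume i: "i \<in> {1..n}"
    show "K *\<^sub>R geo_mean t (\<Phi> X) (\<Phi> (A i)) \<le> \<Phi> (geo_mean t X (A i))"
      unfolding K_def h0 X_def using \<rho> i
      by (intro positive_map_geo_mean_ge \<Phi> t dom.power_mean_ratio_bounds A_le
          dom.posdef_power_mean assms(6)) simp_all
    show "0 \<le> w i" by (rule dom.w_nonneg[OF i])
  qed
  also have "\<dots> = \<Phi> (\<Sum>i=1..n. w i *\<^sub>R geo_mean t X (A i))"
    by (simp add: positive_map_sum[OF \<Phi>(1)] positive_map_scaleR[OF \<Phi>(1)])
  also have "\<dots> = \<Phi> X" by (simp only: X(2))
  finally have KY: "K *\<^sub>R img.mean_map (\<Phi> X) \<le> \<Phi> X" .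
  define r where "r = K powr (- 1/t)"
  have r: "0 < r" using K0 by (simp add: r_def)
  \<comment> \<open>The exponent \<open>1/t\<close> is the one for which homogeneity of degree \<open>1 - t\<close> absorbs \<open>K\<close>.\<close>
  have rK: "r powr (1 - t) = r * K"
  proof -
    have "- 1/t * (1 - t) = - 1/t + 1" using t by (simp add: right_diff_distrib)
    then have "r powr (1 - t) = K powr (- 1/t + 1)" by (simp only: r_def powr_powr)
    also have "\<dots> = r * K powr 1" by (simp only: r_def powr_add)
    finally show ?thesis using K0 by simp
  qed
  have "img.mean_map (r *\<^sub>R \<Phi> X) = r *\<^sub>R K *\<^sub>R img.mean_map (\<Phi> X)"
    unfolding img.mean_map_scaleR[OF pY r] rK by simp
  also have "\<dots> \<le> r *\<^sub>R \<Phi> X" using KY r by (intro scaleR_left_mono) simp_all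
  finally have "Q \<le> r *\<^sub>R \<Phi> X"
    unfolding Q_def
    by (rule img.subsolution_le_supersolution[OF posdef_scaleR[OF pY r] _ img.posdef_power_mean])
      (simp only: img.mean_map_power_mean order_refl)
  then have "K powr (1/t) *\<^sub>R Q \<le> K powr (1/t) *\<^sub>R r *\<^sub>R \<Phi> X"
    by (intro scaleR_left_mono) simp_all
  also have "K powr (1/t) *\<^sub>R r *\<^sub>R \<Phi> X = \<Phi> X"
  proof -
    have "K powr (1/t) * r = K powr (1/t + - 1/t)" by (simp only: r_def powr_add)
    then show ?thesis using K0 by simp
  qed
  finally show ?thesis by (simp only: K_def Q_def X_def)
qed

end
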